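(* Let $\mathcal{A}$ be a countable pca whose underlying set is $\omega$. If the partial application operation of $\mathcal{A}$ is partial computable relative to $X\subseteq\omega$, then $\mathrm{ord}(\mathcal{A})\leq\omega_1^X$. In particular, $\mathrm{ord}(\mathcal{A})$ is countable.
   Context: A pca is a set $\mathcal{A}$ with a partial binary application $ab$ (associating to the left) containing $K,S$ with $Kab$ defined and equal to $a$, and $Sab$ defined with $Sabc\simeq ac(bc)$ for all $a,b,c$. Closed terms are built from elements by application; $s\simeq t$ means both undefined or both defined and equal. Relations $\sim_\alpha$ on closed terms: $s\sim_0 t$ iff $s\simeq t$; $s \sim_{\alpha+1} t$ iff $sx \sim_\alpha tx$ for all $x\in\mathcal{A}$; for limit $\alpha$, $s\sim_\alpha t$ iff $s\sim_\beta t$ for some $\beta<\alpha$. $\mathrm{ord}(\mathcal{A})$ is the least $\alpha$ with $\sim_\alpha=\sim_{\alpha+1}$. $\omega_1^X$ is the least ordinal not computable relative to $X$. *)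

theory Defs
  imports Main "HOL-Library.Countable_Set"
begin

section \<open>Ordinals\<close>

text \<open>
  HOL has no type of all ordinals.  The type below is a copy of the initial ordinal of the
  cardinal of the type \<open>nat set set\<close>, that is, of \<open>2 ^ (2 ^ aleph_0)\<close>, viewed as the set of all
  smaller ordinals.  It is closed under successors and contains \<open>\<omega>\<^sub>1\<close> and many larger ordinals, so
  countability is not built in; lemmas \<open>ex_pca_ord\<close> and \<open>ex_not_computable_ordinal\<close> show that the
  least ordinals taken below really exist in it.
\<close>

typedef ordinal = "UNIV :: nat set set set"
  by simp

instantiation ordinal :: wellorder
begin

definition less_eq_ordinal :: "ordinal \<Rightarrow> ordinal \<Rightarrow> bool" where
  "\<alpha> \<le> \<beta> \<longleftrightarrow> (Rep_ordinal \<alpha>, Rep_ordinal \<beta>) \<in> card_of (UNIV :: nat set set set)"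

definition less_ordinal :: "ordinal \<Rightarrow> ordinal \<Rightarrow> bool" where
  "\<alpha> < \<beta> \<longleftrightarrow> \<alpha> \<le> \<beta> \<and> \<alpha> \<noteq> (\<beta> :: ordinal)"

instance
proof -
  let ?r = "card_of (UNIV :: nat set set set)"
  have wo: "well_order_on UNIV ?r"
    by (rule card_of_well_order_on)
  then have lin: "linear_order_on UNIV ?r" and wf: "wf (?r - Id)"
    by (auto simp: well_order_on_def)
  from lin have refl: "refl ?r" and trans: "trans ?r" and anti: "antisym ?r" and tot: "total ?r"
    by (auto simp: linear_order_on_def partial_order_on_def preorder_on_def)
  have a: "x = y" if "x \<le> y" "y \<le> x" for x y :: ordinal
    using that anti unfolding less_eq_ordinal_def antisym_def by (metis Rep_ordinal_inject)
  have t: "x \<le> z" if "x \<le> y" "y \<le> z" for x y z :: ordinal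
    using that trans unfolding less_eq_ordinal_def trans_def by blast
  have f: "x \<le> x" for x :: ordinal
    using refl unfolding less_eq_ordinal_def refl_on_def by blast
  have l: "x \<le> y \<or> y \<le> x" for x y :: ordinal
    using tot refl unfolding less_eq_ordinal_def total_on_def refl_on_def by (metis UNIV_I)
  have i: "P x" if *: "\<And>x. (\<And>y. y < x \<Longrightarrow> P y) \<Longrightarrow> P x" for P :: "ordinal \<Rightarrow> bool" and x
  proof -
    have "wf (inv_image (?r - Id) Rep_ordinal)"
      using wf by (rule wf_inv_image)
    then show ?thesis
    proof (induction x rule: wf_induct_rule)
      case (less x)
      then show ?case
        by (rule *) (auto simp: less_ordinal_def less_eq_ordinal_def Rep_ordinal_inject)
    qed
  qed
  show "OFCLASS(ordinal, wellorder_class)"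
  proof
    show "x < y \<longleftrightarrow> x \<le> y \<and> \<not> y \<le> x" for x y :: ordinal
      using a f unfolding less_ordinal_def by blast
  qed (fact f t a l i)+
qed

end

definition ozero :: ordinal where
  "ozero = (LEAST \<alpha>. True)"

definition osuc :: "ordinal \<Rightarrow> ordinal" where
  "osuc \<alpha> = (LEAST \<beta>. \<alpha> < \<beta>)"

definition olimit :: "ordinal \<Rightarrow> bool" where
  "olimit \<alpha> \<longleftrightarrow> \<alpha> \<noteq> ozero \<and> (\<forall>\<beta>. \<alpha> \<noteq> osuc \<beta>)"

lemma ozero_le: "ozero \<le> \<alpha>"
  unfolding ozero_def by (simp add: Least_le)

lemma ex_greater_ordinal: "\<exists>\<beta>. \<alpha> < (\<beta> :: ordinal)"
proof -
  let ?r = "card_of (UNIV :: nat set set set)"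
  have inf: "infinite (UNIV :: nat set set set)"
    by (simp add: Finite_Set.finite_set)
  have "\<exists>b\<in>Field ?r. Rep_ordinal \<alpha> \<noteq> b \<and> (Rep_ordinal \<alpha>, b) \<in> ?r"
    by (rule infinite_Card_order_limit) (use inf in \<open>simp_all add: Field_card_of card_of_card_order_on\<close>)
  then obtain b where "Rep_ordinal \<alpha> \<noteq> b" "(Rep_ordinal \<alpha>, b) \<in> ?r"
    by blast
  then have "\<alpha> < Abs_ordinal b"
    by (auto simp: less_ordinal_def less_eq_ordinal_def Abs_ordinal_inverse)
  then show ?thesis ..
qed

lemma less_osuc: "\<alpha> < osuc \<alpha>"
  unfolding osuc_def by (rule LeastI_ex) (rule ex_greater_ordinal)

lemma osuc_le_iff: "osuc \<alpha> \<le> \<beta> \<longleftrightarrow> \<alpha> < \<beta>"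
proof
  show "osuc \<alpha> \<le> \<beta> \<Longrightarrow> \<alpha> < \<beta>"
    using less_osuc[of \<alpha>] by (rule less_le_trans)
  show "\<alpha> < \<beta> \<Longrightarrow> osuc \<alpha> \<le> \<beta>"
    unfolding osuc_def by (rule Least_le)
qed

lemma osuc_inject: "osuc \<alpha> = osuc \<beta> \<longleftrightarrow> \<alpha> = \<beta>"
proof
  assume *: "osuc \<alpha> = osuc \<beta>"
  have "\<alpha> \<le> \<beta>" "\<beta> \<le> \<alpha>"
    using less_osuc[of \<alpha>] less_osuc[of \<beta>] osuc_le_iff[of \<alpha> \<beta>] osuc_le_iff[of \<beta> \<alpha>] *
    by auto
  then show "\<alpha> = \<beta>"
    by simp
qed simp

lemma osuc_neq_ozero: "osuc \<alpha> \<noteq> ozero"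
  using less_osuc[of \<alpha>] ozero_le[of \<alpha>] by auto

lemma ordinal_cases:
  obtains "\<alpha> = ozero" | \<beta> where "\<alpha> = osuc \<beta>" | "olimit \<alpha>"
  unfolding olimit_def by blast

section \<open>Computability relative to a set\<close>

datatype recfn =
    Zero
  | Succ
  | Proj nat
  | Oracle
  | Comp recfn "recfn list"
  | PrimRec recfn recfn
  | Mu recfn

text \<open>
  \<open>calc X F xs y\<close>: the partial recursive function with index \<open>F\<close>, relative to
  the characteristic function of \<open>X\<close>, is defined on the argument tuple \<open>xs\<close>, with value \<open>y\<close>.
\<close>

inductive calc :: "nat set \<Rightarrow> recfn \<Rightarrow> nat list \<Rightarrow> nat \<Rightarrow> bool" for X where
  zero: "calc X Zero xs 0"
| succ: "calc X Succ [x] (Suc x)"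
| proj: "i < length xs \<Longrightarrow> calc X (Proj i) xs (xs ! i)"
| query: "calc X Oracle [x] (if x \<in> X then 1 else 0)"
| comp: "list_all2 (\<lambda>G y. calc X G xs y) Gs ys \<Longrightarrow> calc X F ys z \<Longrightarrow> calc X (Comp F Gs) xs z"
| primrec_0: "calc X F xs y \<Longrightarrow> calc X (PrimRec F G) (0 # xs) y"
| primrec_Suc: "calc X (PrimRec F G) (n # xs) y \<Longrightarrow> calc X G (n # y # xs) z \<Longrightarrow>
    calc X (PrimRec F G) (Suc n # xs) z"
| mu: "calc X F (n # xs) 0 \<Longrightarrow> (\<And>m. m < n \<Longrightarrow> \<exists>k. calc X F (m # xs) (Suc k)) \<Longrightarrow>
    calc X (Mu F) xs n"

definition partial_computable2 :: "nat set \<Rightarrow> (nat \<Rightarrow> nat \<Rightarrow> nat option) \<Rightarrow> bool" where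
  "partial_computable2 X f \<longleftrightarrow> (\<exists>F. \<forall>a b c. f a b = Some c \<longleftrightarrow> calc X F [a, b] c)"

definition computable_rel :: "nat set \<Rightarrow> nat rel \<Rightarrow> bool" where
  "computable_rel X r \<longleftrightarrow> partial_computable2 X (\<lambda>m n. Some (if (m, n) \<in> r then 1 else 0))"

text \<open>
  An ordinal is computable relative to \<open>X\<close> if it is the order type of an \<open>X\<close>-computable
  well-ordering of a subset of \<open>\<omega>\<close>.  Well-orders are reflexive here, so their field is
  \<open>X\<close>-computable as well.
\<close>

definition below :: "ordinal \<Rightarrow> ordinal rel" where
  "below \<alpha> = {(\<beta>, \<gamma>). \<beta> \<le> \<gamma> \<and> \<gamma> < \<alpha>}"

definition computable_ordinal :: "nat set \<Rightarrow> ordinal \<Rightarrow> bool" where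
  "computable_ordinal X \<alpha> \<longleftrightarrow> (\<exists>r. Well_order r \<and> computable_rel X r \<and> (r, below \<alpha>) \<in> ordIso)"

definition omega1 :: "nat set \<Rightarrow> ordinal" where
  "omega1 X = (LEAST \<alpha>. \<not> computable_ordinal X \<alpha>)"

section \<open>Partial combinatory algebras\<close>

datatype 'a cterm = Elem 'a | App "'a cterm" "'a cterm"

text \<open>The value of a closed term; \<open>None\<close> means undefined.\<close>

fun val :: "('a \<Rightarrow> 'a \<Rightarrow> 'a option) \<Rightarrow> 'a cterm \<Rightarrow> 'a option" where
  "val app (Elem a) = Some a"
| "val app (App s t) =
     (case (val app s, val app t) of (Some a, Some b) \<Rightarrow> app a b | _ \<Rightarrow> None)"

definition kleene_eq :: "('a \<Rightarrow> 'a \<Rightarrow> 'a option) \<Rightarrow> 'a cterm \<Rightarrow> 'a cterm \<Rightarrow> bool" where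
  "kleene_eq app s t \<longleftrightarrow> val app s = val app t"

definition pca :: "('a \<Rightarrow> 'a \<Rightarrow> 'a option) \<Rightarrow> bool" where
  "pca app \<longleftrightarrow> (\<exists>K S.
     (\<forall>a b. val app (App (App (Elem K) (Elem a)) (Elem b)) = Some a) \<and>
     (\<forall>a b. val app (App (App (Elem S) (Elem a)) (Elem b)) \<noteq> None) \<and>
     (\<forall>a b c. kleene_eq app
        (App (App (App (Elem S) (Elem a)) (Elem b)) (Elem c))
        (App (App (Elem a) (Elem c)) (App (Elem b) (Elem c)))))"

text \<open>
  The relations \<open>\<sim>\<^sub>\<alpha>\<close>, by transfinite recursion on \<open>\<alpha>\<close>.  Exactly one rule applies to each \<open>\<alpha>\<close>,
  so the defining equivalences hold; see \<open>sim_ozero\<close>, \<open>sim_osuc\<close> and \<open>sim_olimit\<close>.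
\<close>

inductive sim :: "('a \<Rightarrow> 'a \<Rightarrow> 'a option) \<Rightarrow> ordinal \<Rightarrow> 'a cterm \<Rightarrow> 'a cterm \<Rightarrow> bool" for app where
  zero: "kleene_eq app s t \<Longrightarrow> sim app ozero s t"
| suc: "(\<And>x. sim app \<alpha> (App s (Elem x)) (App t (Elem x))) \<Longrightarrow> sim app (osuc \<alpha>) s t"
| limit: "olimit \<alpha> \<Longrightarrow> \<beta> < \<alpha> \<Longrightarrow> sim app \<beta> s t \<Longrightarrow> sim app \<alpha> s t"

lemma sim_ozero: "sim app ozero s t \<longleftrightarrow> kleene_eq app s t"
  by (subst sim.simps) (use osuc_neq_ozero in \<open>auto simp: olimit_def dest: sym\<close>)

lemma sim_osuc: "sim app (osuc \<alpha>) s t \<longleftrightarrow> (\<forall>x. sim app \<alpha> (App s (Elem x)) (App t (Elem x)))"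
  by (subst sim.simps) (auto simp: olimit_def osuc_neq_ozero osuc_inject)

lemma sim_olimit: "olimit \<alpha> \<Longrightarrow> sim app \<alpha> s t \<longleftrightarrow> (\<exists>\<beta><\<alpha>. sim app \<beta> s t)"
  by (subst sim.simps) (auto simp: olimit_def)

text \<open>
  Only used for the carrier \<open>\<omega>\<close>, where the type \<open>ordinal\<close> is known to be long enough.
\<close>

definition pca_ord :: "(nat \<Rightarrow> nat \<Rightarrow> nat option) \<Rightarrow> ordinal" where
  "pca_ord app = (LEAST \<alpha>. sim app \<alpha> = sim app (osuc \<alpha>))"

section \<open>The least ordinals above exist\<close>

lemma sim_le_osuc: "sim app \<alpha> s t \<Longrightarrow> sim app (osuc \<alpha>) s t"
proof (induction \<alpha> s t rule: sim.induct)
  case (zero s t)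
  then show ?case
    by (simp add: sim_osuc sim_ozero kleene_eq_def)
next
  case (suc \<alpha> s t)
  then show ?case
    by (simp add: sim_osuc)
next
  case (limit \<alpha> \<beta> s t)
  then show ?case
    by (auto simp: sim_osuc intro: sim.limit)
qed

lemma sim_mono: "\<alpha> \<le> \<beta> \<Longrightarrow> sim app \<alpha> s t \<Longrightarrow> sim app \<beta> s t"
proof (induction \<beta> rule: less_induct)
  case (less \<beta>)
  show ?case
  proof (cases "\<alpha> = \<beta>")
    case False
    with less.prems have lt: "\<alpha> < \<beta>"
      by simp
    show ?thesis
    proof (cases \<beta> rule: ordinal_cases)
      case 1
      then show ?thesis
        using lt ozero_le[of \<alpha>] by simp
    next
      case (2 \<gamma>)
      then have "\<alpha> \<le> \<gamma>"
        using lt osuc_le_iff[of \<gamma> \<alpha>] by (meson not_less)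
      then show ?thesis
        using 2 less sim_le_osuc less_osuc by blast
    next
      case 3
      then show ?thesis
        using lt less.prems by (auto intro: sim.limit)
    qed
  qed (use less.prems in auto)
qed

lemma no_inj_ordinal: "\<not> inj (f :: ordinal \<Rightarrow> nat set)"
proof
  assume f: "inj f"
  have "inj Abs_ordinal"
    by (rule injI) (simp add: Abs_ordinal_inject)
  with f have "inj (f \<circ> Abs_ordinal)"
    by (rule inj_compose)
  then have "surj (inv (f \<circ> Abs_ordinal))"
    by (rule inj_imp_surj_inv)
  then show False
    using Cantors_theorem[of "UNIV :: nat set set"] by auto
qed

instance cterm :: (countable) countable
  by countable_datatype

theorem ex_pca_ord: "\<exists>\<alpha>. sim app \<alpha> = sim (app :: nat \<Rightarrow> nat \<Rightarrow> nat option) (osuc \<alpha>)"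
proof (rule ccontr)
  assume *: "\<nexists>\<alpha>. sim app \<alpha> = sim app (osuc \<alpha>)"
  have neq: "sim app \<alpha> \<noteq> sim app \<beta>" if "\<alpha> < \<beta>" for \<alpha> \<beta>
  proof
    assume "sim app \<alpha> = sim app \<beta>"
    moreover have "osuc \<alpha> \<le> \<beta>"
      using that by (simp add: osuc_le_iff)
    ultimately have "sim app (osuc \<alpha>) s t \<longleftrightarrow> sim app \<alpha> s t" for s t
      using sim_mono sim_le_osuc by metis
    then have "sim app \<alpha> = sim app (osuc \<alpha>)"
      by (intro ext) simp
    then show False
      using * by blast
  qed
  define f where "f = (\<lambda>\<alpha>. to_nat ` {(s, t). sim app \<alpha> s t})"
  have "inj f"
  proof (rule injI)
    fix \<alpha> \<beta>
    assume "f \<alpha> = f \<beta>"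
    then have "{(s, t). sim app \<alpha> s t} = {(s, t). sim app \<beta> s t}"
      by (simp add: f_def inj_image_eq_iff)
    then have "sim app \<alpha> = sim app \<beta>"
      by (auto simp: set_eq_iff fun_eq_iff)
    then show "\<alpha> = \<beta>"
      using neq by (metis linorder_neq_iff)
  qed
  then show False
    using no_inj_ordinal by blast
qed

theorem ex_not_computable_ordinal: "\<exists>\<alpha>. \<not> computable_ordinal X \<alpha>"
proof (rule ccontr)
  assume "\<nexists>\<alpha>. \<not> computable_ordinal X \<alpha>"
  then have "\<forall>\<alpha> :: ordinal. \<exists>r :: nat rel. (r, below \<alpha>) \<in> ordIso"
    unfolding computable_ordinal_def by blast
  then obtain r :: "ordinal \<Rightarrow> nat rel" where r: "\<And>\<alpha>. (r \<alpha>, below \<alpha>) \<in> ordIso"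
    using choice[of "\<lambda>\<alpha> r. (r, below \<alpha>) \<in> ordIso"] by blast
  have neq: "r \<alpha> \<noteq> r \<beta>" if "\<alpha> < \<beta>" for \<alpha> \<beta>
  proof
    assume eq: "r \<alpha> = r \<beta>"
    have iso: "(below \<alpha>, below \<beta>) \<in> ordIso"
      by (rule ordIso_transitive[OF ordIso_symmetric[OF r] r[of \<beta>, folded eq]])
    have "Well_order (below \<beta>)"
      using r[of \<beta>] by (auto simp: ordIso_def)
    moreover have "(\<alpha>, \<alpha>) \<in> below \<beta>"
      using that by (auto simp: below_def)
    then have "Field (below \<beta>) \<noteq> {}"
      unfolding Field_def by blast
    ultimately have "(Restr (below \<beta>) (underS (below \<beta>) \<alpha>), below \<beta>) \<in> ordLess"
      by (intro underS_Restr_ordLess)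
    moreover have "Restr (below \<beta>) (underS (below \<beta>) \<alpha>) = below \<alpha>"
      using that by (auto simp: underS_def below_def)
    ultimately have "(below \<alpha>, below \<beta>) \<in> ordLess"
      by simp
    then show False
      using iso not_ordLess_ordIso by blast
  qed
  have "inj (\<lambda>\<alpha>. to_nat ` r \<alpha>)"
  proof (rule injI)
    fix \<alpha> \<beta>
    assume "to_nat ` r \<alpha> = to_nat ` r \<beta>"
    then have "r \<alpha> = r \<beta>"
      by (simp add: inj_image_eq_iff)
    then show "\<alpha> = \<beta>"
      using neq by (metis linorder_neq_iff)
  qed
  then show False
    using no_inj_ordinal by blast
qed

end

theory Submission
  imports Defs
begin

text \<open>
  If \<open>s \<sim>\<^sub>\<alpha> t\<close> for some \<open>\<alpha>\<close>, then along every sequence of arguments \<open>s\<close> and \<open>t\<close> become equal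
  after finitely many steps. The tree of argument sequences that still distinguish \<open>s\<close> from \<open>t\<close> is
  well-founded, but its nodes are given by a \<open>\<Sigma>\<^sub>2\<close> condition. Adding witnesses to the nodes embeds it
  into an \<open>X\<close>-computable well-founded tree, whose Kleene--Brouwer order is a computable well-order.
  A child is smaller than its parent in that order, so induction on the rank \<open>\<rho>\<close> of a node in it
  shows that the terms at the node are related by \<open>\<sim>\<^sub>\<rho>\<^sub>+\<^sub>1\<close>. Hence \<open>s \<sim>\<^sub>\<beta> t\<close> for some computable
  \<open>\<beta>\<close>, so \<open>\<sim>\<^sub>\<alpha>\<close> is contained in \<open>\<sim>\<close> at \<open>\<omega>\<^sub>1\<^sup>X\<close> for every \<open>\<alpha>\<close>.
\<close>

section \<open>Computable functions of several variables\<close>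

inductive_cases calc_elims:
  "calc X Zero xs y" "calc X Succ xs y" "calc X (Proj i) xs y" "calc X Oracle xs y"
  "calc X (Comp F Gs) xs y" "calc X (PrimRec F G) xs y" "calc X (Mu F) xs y"

lemma calc_functional: "calc X F xs y \<Longrightarrow> calc X F xs z \<Longrightarrow> y = z"
proof (induction F xs y arbitrary: z rule: calc.induct)
  case (comp xs Gs ys F w)
  obtain ys' where ys': "list_all2 (\<lambda>G y. calc X G xs y) Gs ys'" "calc X F ys' z"
    by (rule calc_elims(5)[OF comp.prems])
  have "ys = ys'"
    using comp.IH(1) ys'(1) by (intro nth_equalityI) (auto simp: list_all2_conv_all_nth)
  then show ?case
    using ys' comp.IH(2) by blast
next
  case (primrec_0 F xs y G)
  from primrec_0.prems show ?case
    by (rule calc_elims(6)) (use primrec_0.IH in auto)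
next
  case (primrec_Suc F G n xs y w)
  from primrec_Suc.prems show ?case
    by (rule calc_elims(6)) (use primrec_Suc.IH in auto)
next
  case (mu F n xs)
  have z: "calc X F (z # xs) 0" "\<And>m. m < z \<Longrightarrow> \<exists>k. calc X F (m # xs) (Suc k)"
    by (rule calc_elims(7)[OF mu.prems], blast)+
  \<comment> \<open>A zero below \<open>n\<close> would contradict the positive value of
    \<open>F\<close> there; the other direction is symmetric.\<close>
  have "\<not> z < n"
    using mu.IH(2)[of z] z(1) by fastforce
  moreover have "\<not> n < z"
    using mu.IH(1) z(2)[of n] by fastforce
  ultimately show ?case
    by simp
qed (erule calc_elims; simp)+

text \<open>
  The arguments are given by an environment, whose first \<open>n\<close> entries are read; a bound variable
  becomes a new entry at the front.
\<close>

definition tcomp :: "nat set \<Rightarrow> nat \<Rightarrow> ((nat \<Rightarrow> nat) \<Rightarrow> nat) \<Rightarrow> bool" where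
  "tcomp X n f \<longleftrightarrow> (\<exists>F. \<forall>e. calc X F (map e [0..<n]) (f e))"

abbreviation tdec :: "nat set \<Rightarrow> nat \<Rightarrow> ((nat \<Rightarrow> nat) \<Rightarrow> bool) \<Rightarrow> bool" where
  "tdec X n P \<equiv> tcomp X n (\<lambda>e. of_bool (P e))"

lemma map_case_nat: "map (case_nat a e) [0..<Suc n] = a # map e [0..<n]"
  by (simp add: map_upt_Suc del: upt_Suc)

section \<open>Closure under substitution and primitive recursion\<close>

lemma tcomp_var: "i < n \<Longrightarrow> tcomp X n (\<lambda>e. e i)"
  unfolding tcomp_def
  by (rule exI[of _ "Proj i"]) (use calc.proj[of i "map e [0..<n]" X for e] in simp)

lemma tcomp_subst:
  assumes "tcomp X m f" and "\<And>i. i < m \<Longrightarrow> tcomp X n (g i)"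
  shows "tcomp X n (\<lambda>e. f (\<lambda>i. g i e))"
proof -
  obtain F where F: "\<And>e. calc X F (map e [0..<m]) (f e)"
    using assms(1) unfolding tcomp_def by blast
  have "\<forall>i<m. \<exists>G. \<forall>e. calc X G (map e [0..<n]) (g i e)"
    using assms(2) unfolding tcomp_def by blast
  then obtain G where G: "\<And>i e. i < m \<Longrightarrow> calc X (G i) (map e [0..<n]) (g i e)"
    by metis
  have "calc X (Comp F (map G [0..<m])) (map e [0..<n]) (f (\<lambda>i. g i e))" for e
    by (rule calc.comp[OF _ F]) (use G in \<open>auto simp: list_all2_conv_all_nth\<close>)
  then show ?thesis
    unfolding tcomp_def by blast
qed

lemma tcomp_comp1:
  assumes "tcomp X 1 (\<lambda>e. f (e 0))" "tcomp X n a"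
  shows "tcomp X n (\<lambda>e. f (a e))"
  using tcomp_subst[OF assms(1), of n "\<lambda>i. a"] assms(2) by simp

lemma tcomp_comp2:
  assumes "tcomp X 2 (\<lambda>e. f (e 0) (e 1))" "tcomp X n a" "tcomp X n b"
  shows "tcomp X n (\<lambda>e. f (a e) (b e))"
  using tcomp_subst[OF assms(1), of n "\<lambda>i. if i = 0 then a else b"] assms(2,3) by simp

lemma tcomp_comp3:
  assumes "tcomp X 3 (\<lambda>e. f (e 0) (e 1) (e 2))" "tcomp X n a" "tcomp X n b" "tcomp X n c"
  shows "tcomp X n (\<lambda>e. f (a e) (b e) (c e))"
  using tcomp_subst[OF assms(1), of n "\<lambda>i. if i = 0 then a else if i = 1 then b else c"] assms(2-4)
  by simp

lemma tcomp_Suc: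
  assumes "tcomp X n a"
  shows "tcomp X n (\<lambda>e. Suc (a e))"
  by (rule tcomp_comp1[OF _ assms, of Suc])
    (auto simp: tcomp_def intro!: exI[of _ Succ] calc.succ)

lemma tcomp_oracle:
  assumes "tcomp X n a"
  shows "tdec X n (\<lambda>e. a e \<in> X)"
  using calc.query[of X]
  by (intro tcomp_comp1[OF _ assms, of "\<lambda>x. of_bool (x \<in> X)"])
    (simp add: tcomp_def of_bool_def exI[of _ Oracle])

lemma tcomp_const: "tcomp X n (\<lambda>e. c)"
proof (induction c)
  case 0
  show ?case
    by (auto simp: tcomp_def intro!: exI[of _ Zero] calc.zero)
qed (rule tcomp_Suc)

text \<open>The counter and the previous value enter as variables 0 and 1, in the argument order of
  \<open>PrimRec\<close>, and shift the environment by two. The bound \<open>b\<close> is finally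
  substituted for a fresh first variable.\<close>

lemma tcomp_rec:
  assumes b: "tcomp X n b" and a: "tcomp X n a"
    and g: "tcomp X (Suc (Suc n)) (\<lambda>e. g (e 0) (e 1) (\<lambda>i. e (Suc (Suc i))))"
  shows "tcomp X n (\<lambda>e. rec_nat (a e) (\<lambda>i y. g i y e) (b e))"
proof -
  obtain A G where A: "\<And>e. calc X A (map e [0..<n]) (a e)"
    and G: "\<And>e. calc X G (map e [0..<Suc (Suc n)]) (g (e 0) (e 1) (\<lambda>i. e (Suc (Suc i))))"
    using a g unfolding tcomp_def by blast
  have G': "calc X G (i # y # map e [0..<n]) (g i y e)" for i y e
    using G[of "case_nat i (case_nat y e)"] by (simp add: map_case_nat del: upt_Suc)
  have "calc X (PrimRec A G) (k # map e [0..<n]) (rec_nat (a e) (\<lambda>i y. g i y e) k)" for k e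
    by (induction k) (auto intro: calc.intros A G')
  then have *: "tcomp X (Suc n) (\<lambda>e. rec_nat (a (\<lambda>i. e (Suc i))) (\<lambda>i y. g i y (\<lambda>i. e (Suc i))) (e 0))"
    unfolding tcomp_def
    by (intro exI[of _ "PrimRec A G"])
      (simp add: map_upt_Suc del: upt_Suc)
  show ?thesis
    using tcomp_subst[OF *, of n "case_nat b (\<lambda>i e. e i)"] b
    by (auto simp: tcomp_var split: nat.splits)
qed

section \<open>Arithmetic, connectives and bounded quantifiers\<close>

lemma tcomp_pred:
  assumes "tcomp X n a"
  shows "tcomp X n (\<lambda>e. a e - 1)"
proof (rule tcomp_comp1[OF _ assms])
  have "tcomp X 1 (\<lambda>e. rec_nat 0 (\<lambda>i y. i) (e 0))"
    by (intro tcomp_rec tcomp_const tcomp_var) auto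
  moreover have "rec_nat 0 (\<lambda>i y. i) m = m - 1" for m :: nat
    by (cases m) auto
  ultimately show "tcomp X 1 (\<lambda>e. e 0 - 1)"
    by simp
qed

lemma tcomp_diff:
  assumes "tcomp X n a" "tcomp X n b"
  shows "tcomp X n (\<lambda>e. a e - b e)"
proof (rule tcomp_comp2[OF _ assms])
  have "tcomp X 2 (\<lambda>e. rec_nat (e 0) (\<lambda>i y. y - 1) (e 1))"
    by (intro tcomp_rec tcomp_pred tcomp_var) auto
  moreover have "rec_nat m (\<lambda>i y. y - 1) k = m - k" for m k :: nat
    by (induction k) auto
  ultimately show "tcomp X 2 (\<lambda>e. e 0 - e 1)"
    by simp
qed

lemma tcomp_if:
  assumes "tdec X n P" "tcomp X n a" "tcomp X n b"
  shows "tcomp X n (\<lambda>e. if P e then a e else b e)"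
proof -
  \<comment> \<open>On a truth value 0 or 1, a recursion whose step ignores the previous value is a
    case distinction.\<close>
  have "tcomp X 3 (\<lambda>e. rec_nat (e 2) (\<lambda>i y. e 1) (e 0))"
    by (intro tcomp_rec tcomp_var) auto
  from tcomp_comp3[OF this assms(1,2,3)] show ?thesis
    by (rule back_subst[of "tcomp X n"]) auto
qed

lemma tdec_not:
  assumes "tdec X n P"
  shows "tdec X n (\<lambda>e. \<not> P e)"
  using tcomp_if[OF assms tcomp_const[of X n 0] tcomp_const[of X n 1]]
  by (rule back_subst[of "tcomp X n"]) auto

lemma tdec_conj:
  assumes "tdec X n P" "tdec X n Q"
  shows "tdec X n (\<lambda>e. P e \<and> Q e)"
  using tcomp_if[OF assms tcomp_const[of X n 0]]
  by (rule back_subst[of "tcomp X n"]) auto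

lemma tdec_disj:
  assumes "tdec X n P" "tdec X n Q"
  shows "tdec X n (\<lambda>e. P e \<or> Q e)"
  using tdec_not[OF tdec_conj[OF tdec_not[OF assms(1)] tdec_not[OF assms(2)]]] by simp

lemma tdec_less:
  assumes "tcomp X n a" "tcomp X n b"
  shows "tdec X n (\<lambda>e. a e < b e)"
  \<comment> \<open>By truncated subtraction, \<open>1 - (Suc a - b)\<close> is 1 exactly if
    \<open>a < b\<close>.\<close>
  using tcomp_diff[OF tcomp_const[of X n 1] tcomp_diff[OF tcomp_Suc[OF assms(1)] assms(2)]]
  by (rule back_subst[of "tcomp X n"]) auto

lemma tdec_eq:
  assumes "tcomp X n a" "tcomp X n b"
  shows "tdec X n (\<lambda>e. a e = b e)"
  using tdec_conj[OF tdec_not[OF tdec_less[OF assms]] tdec_not[OF tdec_less[OF assms(2,1)]]]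
  by (rule back_subst[of "tcomp X n"]) (simp add: fun_eq_iff of_bool_def not_less order_eq_iff conj_commute)

lemma tdec_all_less:
  assumes "tcomp X n b" and "tdec X (Suc n) (\<lambda>e. P (e 0) (\<lambda>i. e (Suc i)))"
  shows "tdec X n (\<lambda>e. \<forall>i<b e. P i e)"
proof -
  \<comment> \<open>In the recursion the accumulator lies between the bound variable and the
    environment, so \<open>P\<close> has to skip variable 1.\<close>
  have P: "tdec X (Suc (Suc n)) (\<lambda>e. P (e 0) (\<lambda>i. e (Suc (Suc i))))"
    using tcomp_subst[OF assms(2), of "Suc (Suc n)" "case_nat (\<lambda>e. e 0) (\<lambda>i e. e (Suc (Suc i)))"]
    by (auto simp: tcomp_var split: nat.splits)
  have "tcomp X n (\<lambda>e. rec_nat 1 (\<lambda>i y. if P i e then y else 0) (b e))"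
    by (intro tcomp_rec tcomp_if P assms tcomp_const tcomp_var) auto
  moreover have "rec_nat 1 (\<lambda>i y. if P i e then y else 0) k = (of_bool (\<forall>i<k. P i e) :: nat)" for k e
    by (induction k) (auto simp: less_Suc_eq)
  ultimately show ?thesis
    by (simp only:)
qed

lemma tdec_ex_less:
  assumes "tcomp X n b" and "tdec X (Suc n) (\<lambda>e. P (e 0) (\<lambda>i. e (Suc i)))"
  shows "tdec X n (\<lambda>e. \<exists>i<b e. P i e)"
  using tdec_not[OF tdec_all_less[OF assms(1), of "\<lambda>i e. \<not> P i e", OF tdec_not[OF assms(2)]]]
  by simp

lemma tdec_odd:
  assumes "tcomp X n a"
  shows "tdec X n (\<lambda>e. odd (a e))"
proof (rule tcomp_comp1[OF _ assms])
  have "tcomp X 1 (\<lambda>e. rec_nat 0 (\<lambda>i y. 1 - y) (e 0))"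
    by (intro tcomp_rec tcomp_const tcomp_diff tcomp_var) auto
  moreover have "rec_nat 0 (\<lambda>i y. 1 - y) m = (of_bool (odd m) :: nat)" for m :: nat
    by (induction m) auto
  ultimately show "tdec X 1 (\<lambda>e. odd (e 0))"
    by simp
qed

lemma tcomp_half:
  assumes "tcomp X n a"
  shows "tcomp X n (\<lambda>e. a e div 2)"
proof (rule tcomp_comp1[OF _ assms])
  \<comment> \<open>This counts the odd numbers below the argument.\<close>
  have "tcomp X 1 (\<lambda>e. rec_nat 0 (\<lambda>i y. if odd i then Suc y else y) (e 0))"
    by (intro tcomp_rec tcomp_if tdec_odd tcomp_const tcomp_Suc tcomp_var) auto
  moreover have "rec_nat 0 (\<lambda>i y. if odd i then Suc y else y) m = m div 2" for m :: nat
    by (induction m) auto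
  ultimately show "tcomp X 1 (\<lambda>e. e 0 div 2)"
    by simp
qed

lemma tdec_bit:
  assumes "tcomp X n a" "tcomp X n b"
  shows "tdec X n (\<lambda>e. bit (a e) (b e))"
proof (rule tcomp_comp2[OF _ assms])
  have "tdec X 2 (\<lambda>e. odd (rec_nat (e 0) (\<lambda>i y. y div 2) (e 1)))"
    by (intro tcomp_rec tdec_odd tcomp_half tcomp_var) auto
  moreover have "rec_nat m (\<lambda>i y. y div 2) k = m div 2 ^ k" for m k :: nat
    by (induction k) (auto simp: div_mult2_eq[symmetric] mult.commute)
  ultimately show "tdec X 2 (\<lambda>e. bit (e 0) (e 1))"
    by (simp add: bit_iff_odd)
qed

lemma computable_relI:
  assumes "tdec X 2 (\<lambda>e. (e 0, e 1) \<in> r)"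
  shows "computable_rel X r"
proof -
  obtain F where F: "\<And>e. calc X F (map e [0..<2]) (of_bool ((e 0, e 1) \<in> r))"
    using assms unfolding tcomp_def by blast
  have "calc X F [a, b] (if (a, b) \<in> r then 1 else 0)" for a b
    using F[of "case_nat a (\<lambda>_. b)"] by (simp add: of_bool_def upt_rec)
  \<comment> \<open>Single-valuedness excludes other outputs, as the equivalence in
    \<open>partial_computable2\<close> demands.\<close>
  then show ?thesis
    unfolding computable_rel_def partial_computable2_def
    by (intro exI[of _ F]) (metis calc_functional option.inject)
qed

lemma computable_relD:
  assumes "computable_rel X r"
  shows "tdec X 2 (\<lambda>e. (e 0, e 1) \<in> r)"
proof -
  obtain F where "\<And>a b. calc X F [a, b] (if (a, b) \<in> r then 1 else 0)"
    using assms unfolding computable_rel_def partial_computable2_def by auto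
  then show ?thesis
    unfolding tcomp_def by (intro exI[of _ F]) (simp add: of_bool_def upt_rec)
qed

section \<open>Approximation of partial computable functions by stages\<close>

text \<open>
  Stage \<open>k\<close> of the approximation is \<open>Suc y\<close> if the value \<open>y\<close> has been found and \<open>0\<close> otherwise.
\<close>

definition stages :: "nat set \<Rightarrow> recfn \<Rightarrow> nat \<Rightarrow> (nat \<Rightarrow> nat list \<Rightarrow> nat) \<Rightarrow> bool" where
  "stages X F n h \<longleftrightarrow>
     tcomp X (Suc n) (\<lambda>e. h (e 0) (map (\<lambda>i. e (Suc i)) [0..<n])) \<and>
     (\<forall>k xs y. length xs = n \<longrightarrow> h k xs = Suc y \<longrightarrow> calc X F xs y) \<and>
     (\<forall>xs y. length xs = n \<longrightarrow> calc X F xs y \<longrightarrow> (\<forall>\<^sub>F k in sequentially. h k xs = Suc y))"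

lemma stagesI:
  assumes "tcomp X (Suc n) (\<lambda>e. h (e 0) (map (\<lambda>i. e (Suc i)) [0..<n]))"
    and "\<And>k xs y. length xs = n \<Longrightarrow> h k xs = Suc y \<Longrightarrow> calc X F xs y"
    and "\<And>xs y. length xs = n \<Longrightarrow> calc X F xs y \<Longrightarrow> \<forall>\<^sub>F k in sequentially. h k xs = Suc y"
  shows "stages X F n h"
  using assms unfolding stages_def by blast

lemma stages_tcomp:
  assumes "stages X F n h" "tcomp X m a" "\<And>i. i < n \<Longrightarrow> tcomp X m (g i)"
  shows "tcomp X m (\<lambda>e. h (a e) (map (\<lambda>i. g i e) [0..<n]))"
proof -
  have "tcomp X (Suc n) (\<lambda>e. h (e 0) (map (\<lambda>i. e (Suc i)) [0..<n]))"
    using assms(1) unfolding stages_def by blast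
  from tcomp_subst[OF this, of m "case_nat a g"] show ?thesis
    using assms(2,3) by (auto split: nat.splits)
qed

lemma stages_sound: "stages X F n h \<Longrightarrow> length xs = n \<Longrightarrow> h k xs = Suc y \<Longrightarrow> calc X F xs y"
  unfolding stages_def by blast

lemma stages_complete:
  "stages X F n h \<Longrightarrow> length xs = n \<Longrightarrow> calc X F xs y \<Longrightarrow> \<forall>\<^sub>F k in sequentially. h k xs = Suc y"
  unfolding stages_def by blast

text \<open>Settles the indices applied at a wrong arity, such as \<open>Succ\<close> for
  \<open>n \<noteq> 1\<close>.\<close>

lemma ex_stages_undefined: "(\<And>xs y. length xs = n \<Longrightarrow> \<not> calc X F xs y) \<Longrightarrow> \<exists>h. stages X F n h"
  by (rule exI[of _ "\<lambda>k xs. 0"], rule stagesI) (auto intro: tcomp_const)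

text \<open>Here the bound is a fixed number and each \<open>P i\<close> may have its own program,
  so a finite conjunction replaces a recursion.\<close>

lemma tdec_all_fixed: "(\<And>i. i < (m :: nat) \<Longrightarrow> tdec X n (P i)) \<Longrightarrow> tdec X n (\<lambda>e. \<forall>i<m. P i e)"
proof (induction m)
  case (Suc m)
  then have "tdec X n (\<lambda>e. P m e \<and> (\<forall>i<m. P i e))"
    by (intro tdec_conj) auto
  then show ?case
    by (simp add: All_less_Suc)
qed (use tcomp_const[of X n 1] in simp)

text \<open>All functions are run to the same stage, and the outer one starts only when each inner
  one has a value. Finitely many stabilizations have a common stage.\<close>

lemma stages_Comp:
  assumes F: "stages X F (length Gs) f" and G: "\<And>i. i < length Gs \<Longrightarrow> stages X (Gs ! i) n (g i)"
  shows "stages X (Comp F Gs) n (\<lambda>k xs. if \<forall>i<length Gs. g i k xs \<noteq> 0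
    then f k (map (\<lambda>i. g i k xs - 1) [0..<length Gs]) else 0)"
proof (rule stagesI)
  have g: "tcomp X (Suc n) (\<lambda>e. g i (e 0) (map (\<lambda>i. e (Suc i)) [0..<n]))" if "i < length Gs" for i
    using G[OF that] unfolding stages_def by blast
  show "tcomp X (Suc n) (\<lambda>e. if \<forall>i<length Gs. g i (e 0) (map (\<lambda>i. e (Suc i)) [0..<n]) \<noteq> 0
    then f (e 0) (map (\<lambda>i. g i (e 0) (map (\<lambda>i. e (Suc i)) [0..<n]) - 1) [0..<length Gs]) else 0)"
    by (intro tcomp_if tdec_all_fixed tdec_not tdec_eq stages_tcomp[OF F] tcomp_pred g tcomp_const
        tcomp_var) auto
next
  fix k xs y
  assume len: "length xs = n"
    and "(if \<forall>i<length Gs. g i k xs \<noteq> 0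
      then f k (map (\<lambda>i. g i k xs - 1) [0..<length Gs]) else 0) = Suc y"
  then have nz: "\<forall>i<length Gs. g i k xs \<noteq> 0"
    and fk: "f k (map (\<lambda>i. g i k xs - 1) [0..<length Gs]) = Suc y"
    by (auto split: if_splits)
  have "calc X (Gs ! i) xs (g i k xs - 1)" if "i < length Gs" for i
    using stages_sound[OF G[OF that] len] nz that by simp
  then show "calc X (Comp F Gs) xs y"
    by (intro calc.comp[OF _ stages_sound[OF F _ fk]]) (auto simp: list_all2_conv_all_nth)
next
  fix xs y
  assume len: "length xs = n" and "calc X (Comp F Gs) xs y"
  then obtain ys where ys: "list_all2 (\<lambda>G y. calc X G xs y) Gs ys" and y: "calc X F ys y"
    by (auto elim: calc_elims(5))
  then have leny: "length ys = length Gs"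
    by (simp add: list_all2_lengthD)
  have "\<forall>\<^sub>F k in sequentially. \<forall>i\<in>{..<length Gs}. g i k xs = Suc (ys ! i)"
    by (intro eventually_ball_finite ballI stages_complete[OF G len])
      (use ys in \<open>auto simp: list_all2_conv_all_nth\<close>)
  with stages_complete[OF F leny y]
  show "\<forall>\<^sub>F k in sequentially. (if \<forall>i<length Gs. g i k xs \<noteq> 0
    then f k (map (\<lambda>i. g i k xs - 1) [0..<length Gs]) else 0) = Suc y"
  proof eventually_elim
    case (elim k)
    then have "map (\<lambda>i. g i k xs - 1) [0..<length Gs] = ys"
      using leny by (intro nth_equalityI) auto
    then show ?case
      using elim by simp
  qed
qed

text \<open>All rounds of the recursion use the same stage, and a missing value 0 is passed on to
  the end. Soundness and stabilization follow by induction on the recursion argument.\<close>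

lemma stages_PrimRec:
  assumes F: "stages X F n f" and G: "stages X G (Suc (Suc n)) g"
  shows "stages X (PrimRec F G) (Suc n) (\<lambda>k xs. rec_nat (f k (tl xs))
    (\<lambda>i y. if y = 0 then 0 else g k (i # (y - 1) # tl xs)) (hd xs))"
proof (rule stagesI)
  \<comment> \<open>Variables 0 and 1 are the counter and the previous value, 2 is the stage, 3 the
    recursion argument, and the parameters start at 4.\<close>
  have g: "tcomp X (Suc (Suc (Suc (Suc n)))) (\<lambda>e. g (e (Suc (Suc 0)))
    (e 0 # (e 1 - 1) # map (\<lambda>i. e (Suc (Suc (Suc (Suc i))))) [0..<n]))"
  proof -
    let ?c = "case_nat (\<lambda>e. e 0) (case_nat (\<lambda>e. e 1 - 1) (\<lambda>i e. e (Suc (Suc (Suc (Suc i))))))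
      :: nat \<Rightarrow> (nat \<Rightarrow> nat) \<Rightarrow> nat"
    have "tcomp X (Suc (Suc (Suc (Suc n)))) (?c i)" if "i < Suc (Suc n)" for i
      using that by (auto intro!: tcomp_pred tcomp_var simp del: One_nat_def split: nat.split)
    from stages_tcomp[OF G, where g = ?c and a = "\<lambda>e. e (Suc (Suc 0))", OF tcomp_var this] show ?thesis
      by (simp add: map_upt_Suc del: upt_Suc)
  qed
  have "tcomp X (Suc (Suc n)) (\<lambda>e. rec_nat (f (e 0) (map (\<lambda>i. e (Suc (Suc i))) [0..<n]))
    (\<lambda>i y. if y = 0 then 0 else g (e 0) (i # (y - 1) # map (\<lambda>i. e (Suc (Suc i))) [0..<n])) (e 1))"
    by (intro tcomp_rec tcomp_if tdec_eq g stages_tcomp[OF F] tcomp_const tcomp_var) auto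
  then show "tcomp X (Suc (Suc n)) (\<lambda>e. rec_nat (f (e 0) (tl (map (\<lambda>i. e (Suc i)) [0..<Suc n])))
    (\<lambda>i y. if y = 0 then 0 else g (e 0) (i # (y - 1) # tl (map (\<lambda>i. e (Suc i)) [0..<Suc n])))
    (hd (map (\<lambda>i. e (Suc i)) [0..<Suc n])))"
    by (simp add: map_upt_Suc del: upt_Suc cong: if_cong)
next
  let ?h = "\<lambda>k xs. rec_nat (f k xs) (\<lambda>i y. if y = 0 then 0 else g k (i # (y - 1) # xs))"
  have sound: "calc X (PrimRec F G) (m # xs) y"
    if "length xs = n" "?h k xs m = Suc y" for k xs m y
    using that(2)
  proof (induction m arbitrary: y)
    case 0
    then show ?case
      using stages_sound[OF F that(1)] by (auto intro: calc.primrec_0)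
  next
    case (Suc m)
    then obtain z where z: "?h k xs m = Suc z" "g k (m # z # xs) = Suc y"
      by (cases "?h k xs m") auto
    show ?case
      using that(1) by (intro calc.primrec_Suc[OF Suc.IH[OF z(1)] stages_sound[OF G _ z(2)]]) simp
  qed
  show "calc X (PrimRec F G) xs y"
    if "length xs = Suc n" "?h k (tl xs) (hd xs) = Suc y" for k xs y
    using sound[of "tl xs" k "hd xs" y] that by (cases xs) auto
  have complete: "\<forall>\<^sub>F k in sequentially. ?h k xs m = Suc y"
    if "length xs = n" "calc X (PrimRec F G) (m # xs) y" for xs m y
    using that(2)
  proof (induction m arbitrary: y)
    case 0
    then have "calc X F xs y"
      by (auto elim: calc_elims(6))
    then show ?case
      using stages_complete[OF F that(1)] by simp
  next
    case (Suc m)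
    then obtain z where "calc X (PrimRec F G) (m # xs) z" and z: "calc X G (m # z # xs) y"
      by (auto elim: calc_elims(6))
    then have "\<forall>\<^sub>F k in sequentially. ?h k xs m = Suc z"
      using Suc.IH by blast
    moreover have "\<forall>\<^sub>F k in sequentially. g k (m # z # xs) = Suc y"
      using that(1) by (intro stages_complete[OF G _ z]) simp
    ultimately show ?case
      by eventually_elim simp
  qed
  show "\<forall>\<^sub>F k in sequentially. ?h k (tl xs) (hd xs) = Suc y"
    if "length xs = Suc n" "calc X (PrimRec F G) xs y" for xs y
    using complete[of "tl xs" "hd xs" y] that by (cases xs) auto
qed

text \<open>
  State \<open>0\<close> of the bounded search means that it goes on, state \<open>1\<close> that it has reached an argument
  without a value, and state \<open>Suc (Suc m)\<close> that it has found the zero \<open>m\<close>.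
\<close>

definition search :: "(nat \<Rightarrow> nat) \<Rightarrow> nat \<Rightarrow> nat" where
  "search f = rec_nat 0 (\<lambda>i y. if y \<noteq> 0 then y else
     if f i = 0 then 1 else if f i = 1 then Suc (Suc i) else 0)"

text \<open>In the intended use \<open>f i\<close> is a stage: 1 stands for the value 0, anything
  above 1 for a positive value.\<close>

lemma search_eq_0_iff: "search f j = 0 \<longleftrightarrow> (\<forall>i<j. f i > 1)"
  by (induction j) (auto simp: search_def less_Suc_eq)

lemma search_eq_Suc_iff: "search f j = Suc (Suc m) \<longleftrightarrow> m < j \<and> f m = 1 \<and> (\<forall>i<m. f i > 1)"
proof (induction j)
  case (Suc j)
  have "search f (Suc j) = (if search f j \<noteq> 0 then search f j else
    if f j = 0 then 1 else if f j = 1 then Suc (Suc j) else 0)"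
    by (simp add: search_def)
  with Suc search_eq_0_iff[of f j] show ?case
    by (auto simp: less_Suc_eq split: if_splits)
qed (simp add: search_def)

text \<open>Stage \<open>k\<close> searches only below \<open>k\<close>. Subtracting 1 sends a
  running and a stuck search to 0, and a found zero \<open>m\<close> to
  \<open>Suc m\<close>.\<close>

lemma stages_Mu:
  assumes F: "stages X F (Suc n) f"
  shows "stages X (Mu F) n (\<lambda>k xs. search (\<lambda>i. f k (i # xs)) k - 1)"
proof (rule stagesI)
  have f: "tcomp X (Suc (Suc (Suc n)))
    (\<lambda>e. f (e (Suc (Suc 0))) (e 0 # map (\<lambda>i. e (Suc (Suc (Suc i)))) [0..<n]))"
  proof -
    let ?c = "case_nat (\<lambda>e. e 0) (\<lambda>i e. e (Suc (Suc (Suc i)))) :: nat \<Rightarrow> (nat \<Rightarrow> nat) \<Rightarrow> nat"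
    have "tcomp X (Suc (Suc (Suc n))) (?c i)" if "i < Suc n" for i
      using that by (auto intro!: tcomp_var split: nat.split)
    from stages_tcomp[OF F, where g = ?c and a = "\<lambda>e. e (Suc (Suc 0))", OF tcomp_var this] show ?thesis
      by (simp add: map_upt_Suc del: upt_Suc)
  qed
  show "tcomp X (Suc n) (\<lambda>e. search (\<lambda>i. f (e 0) (i # map (\<lambda>i. e (Suc i)) [0..<n])) (e 0) - 1)"
    unfolding search_def
    by (intro tcomp_pred tcomp_rec tcomp_if tdec_not tdec_eq f tcomp_Suc tcomp_const tcomp_var) auto
next
  fix k xs m
  assume len: "length xs = n" and "search (\<lambda>i. f k (i # xs)) k - 1 = Suc m"
  then have m: "f k (m # xs) = Suc 0" "\<forall>i<m. f k (i # xs) > 1"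
    using search_eq_Suc_iff[of "\<lambda>i. f k (i # xs)" k m] by auto
  show "calc X (Mu F) xs m"
  proof (rule calc.mu)
    show "calc X F (m # xs) 0"
      using stages_sound[OF F _ m(1)] len by simp
    show "\<exists>y. calc X F (i # xs) (Suc y)" if "i < m" for i
      using stages_sound[OF F, of "i # xs" k "Suc (f k (i # xs) - 2)"] m(2) that len
      by (auto intro!: exI[of _ "f k (i # xs) - 2"])
  qed
next
  fix xs m
  assume len: "length xs = n" and "calc X (Mu F) xs m"
  then have m: "calc X F (m # xs) 0" "\<And>i. i < m \<Longrightarrow> \<exists>y. calc X F (i # xs) (Suc y)"
    by (auto elim: calc_elims(7))
  from m(1) len have "\<forall>\<^sub>F k in sequentially. f k (m # xs) = Suc 0"
    by (intro stages_complete[OF F]) auto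
  moreover have "\<forall>\<^sub>F k in sequentially. f k (i # xs) > 1" if i: "i < m" for i
  proof -
    obtain y where "calc X F (i # xs) (Suc y)"
      using m(2)[OF i] by blast
    then have "\<forall>\<^sub>F k in sequentially. f k (i # xs) = Suc (Suc y)"
      using len by (intro stages_complete[OF F]) auto
    then show ?thesis
      by eventually_elim simp
  qed
  then have "\<forall>\<^sub>F k in sequentially. \<forall>i\<in>{..<m}. f k (i # xs) > 1"
    by (intro eventually_ball_finite) auto
  moreover have "\<forall>\<^sub>F k in sequentially. m < k"
    by (rule eventually_gt_at_top)
  ultimately show "\<forall>\<^sub>F k in sequentially. search (\<lambda>i. f k (i # xs)) k - 1 = Suc m"
  proof eventually_elim
    case (elim k)
    then have "search (\<lambda>i. f k (i # xs)) k = Suc (Suc m)"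
      by (simp add: search_eq_Suc_iff)
    then show ?case
      by simp
  qed
qed

text \<open>Structural induction on the index, for all arities at once because composition,
  recursion and minimization change the arity.\<close>

lemma ex_stages: "\<exists>h. stages X F n h"
proof (induction F arbitrary: n)
  case Zero
  have "stages X Zero n (\<lambda>k xs. 1)"
    by (rule stagesI) (auto intro: tcomp_const calc.zero elim: calc_elims)
  then show ?case
    by blast
next
  case Succ
  show ?case
  proof (cases "n = 1")
    case True
    have "stages X Succ 1 (\<lambda>k xs. Suc (Suc (hd xs)))"
      by (rule stagesI) (auto simp: length_Suc_conv intro!: tcomp_Suc tcomp_var calc.succ elim: calc_elims)
    then show ?thesis
      using True by blast
  next
    case False
    show ?thesis
      by (rule ex_stages_undefined) (use False in \<open>auto elim!: calc_elims\<close>)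
  qed
next
  case (Proj i)
  show ?case
  proof (cases "i < n")
    case True
    have "stages X (Proj i) n (\<lambda>k xs. Suc (xs ! i))"
      by (rule stagesI) (use True in \<open>auto intro!: tcomp_Suc tcomp_var calc.proj elim: calc_elims\<close>)
    then show ?thesis
      by blast
  next
    case False
    show ?thesis
      by (rule ex_stages_undefined) (use False in \<open>auto elim!: calc_elims\<close>)
  qed
next
  case Oracle
  show ?case
  proof (cases "n = 1")
    case True
    have "stages X Oracle 1 (\<lambda>k xs. Suc (of_bool (hd xs \<in> X)))"
    proof (rule stagesI)
      show "calc X Oracle xs y" if "length xs = 1" "Suc (of_bool (hd xs \<in> X)) = Suc y" for xs y
        using that calc.query[of X "hd xs"] by (auto simp: length_Suc_conv of_bool_def)
    qed (auto simp: length_Suc_conv intro!: tcomp_Suc tcomp_oracle tcomp_var elim: calc_elims)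
    then show ?thesis
      using True by blast
  next
    case False
    show ?thesis
      by (rule ex_stages_undefined) (use False in \<open>auto elim!: calc_elims\<close>)
  qed
next
  case (Comp F Gs)
  obtain f where f: "stages X F (length Gs) f"
    using Comp.IH(1) by blast
  have "\<forall>i<length Gs. \<exists>g. stages X (Gs ! i) n g"
    using Comp.IH(2) by simp
  then obtain g where "\<And>i. i < length Gs \<Longrightarrow> stages X (Gs ! i) n (g i)"
    by metis
  from stages_Comp[OF f this] show ?case
    by blast
next
  case (PrimRec F G)
  show ?case
  proof (cases n)
    case 0
    show ?thesis
      by (rule ex_stages_undefined) (use 0 in \<open>auto elim!: calc_elims\<close>)
  next
    case (Suc m)
    obtain f g where "stages X F m f" "stages X G (Suc (Suc m)) g"
      using PrimRec.IH by blast
    from stages_PrimRec[OF this] show ?thesis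
      using Suc by blast
  qed
next
  case (Mu F)
  then obtain f where "stages X F (Suc n) f"
    by blast
  from stages_Mu[OF this] show ?case
    by blast
qed

section \<open>Trees of finite sets\<close>

text \<open>
  A node is a natural number, read as the finite set of its binary digits; its initial segments are
  its prefixes. On these codes the Kleene--Brouwer order is the lexicographic order below.
\<close>

definition precedes :: "nat \<Rightarrow> nat \<Rightarrow> bool" where
  "precedes m n \<longleftrightarrow> (\<exists>d<m. bit m d \<and> \<not> bit n d \<and> (\<forall>j<d. bit m j \<longleftrightarrow> bit n j))"

definition kleene_brouwer :: "nat set \<Rightarrow> nat rel" where
  "kleene_brouwer T = {(m, n). m \<in> T \<and> n \<in> T \<and> (m = n \<or> precedes m n)}"

text \<open>The child stands first, so well-foundedness excludes infinite branches; its new element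
  \<open>p\<close> exceeds all elements of \<open>n\<close>.\<close>

definition child_rel :: "nat set \<Rightarrow> nat rel" where
  "child_rel T = {(set_bit p n, n) |p n. n < 2 ^ p \<and> set_bit p n \<in> T}"

lemma bit_less: "bit (n :: nat) j \<Longrightarrow> j < n"
proof (rule ccontr)
  assume "bit n j" "\<not> j < n"
  then have "n < 2 ^ j"
    by (meson le_less_trans less_exp not_less)
  then show False
    using \<open>bit n j\<close> by (simp add: bit_iff_odd)
qed

lemma not_bit_if_less: "(n :: nat) < 2 ^ k \<Longrightarrow> k \<le> j \<Longrightarrow> \<not> bit n j"
  by (simp add: bit_iff_odd) (metis div_less even_zero less_le_trans one_le_numeral power_increasing)

text \<open>A set digit position is below its number, which supplies the bound \<open>d < m\<close>
  that makes the relation decidable.\<close>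

lemma precedesI:
  "bit m d \<Longrightarrow> \<not> bit n d \<Longrightarrow> (\<And>j. j < d \<Longrightarrow> bit m j \<longleftrightarrow> bit n j) \<Longrightarrow> precedes m n"
  unfolding precedes_def using bit_less by blast

lemma precedes_total: "m \<noteq> n \<Longrightarrow> precedes m n \<or> precedes n m"
proof -
  assume "m \<noteq> n"
  then have ex: "\<exists>d. bit m d \<noteq> bit n d"
    by (auto simp: bit_eq_iff)
  define d where "d = (LEAST d. bit m d \<noteq> bit n d)"
  have "bit m d \<noteq> bit n d"
    unfolding d_def using ex by (rule LeastI_ex)
  moreover have "bit m j = bit n j" if "j < d" for j
    using that not_less_Least unfolding d_def by blast
  ultimately show ?thesis
    using precedesI[of m d n] precedesI[of n d m] by blast
qed

text \<open>The smaller of the two positions of first difference decides.\<close>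

lemma precedes_trans: "precedes l m \<Longrightarrow> precedes m n \<Longrightarrow> precedes l n"
proof -
  assume "precedes l m" "precedes m n"
  then obtain c d where c: "bit l c" "\<not> bit m c" "\<And>j. j < c \<Longrightarrow> bit l j = bit m j"
    and d: "bit m d" "\<not> bit n d" "\<And>j. j < d \<Longrightarrow> bit m j = bit n j"
    unfolding precedes_def by blast
  have "c \<noteq> d"
    using c d by blast
  then consider "c < d" | "d < c"
    by linarith
  then show ?thesis
  proof cases
    case 1
    then show ?thesis
      using c d by (intro precedesI[of l c n]) auto
  next
    case 2
    then show ?thesis
      using c d by (intro precedesI[of l d n]) auto
  qed
qed

lemma precedes_irrefl: "\<not> precedes n n"
  by (auto simp: precedes_def)

lemma Field_kleene_brouwer: "Field (kleene_brouwer T) = T"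
  by (auto simp: kleene_brouwer_def Field_def)

lemma Linear_order_kleene_brouwer: "Linear_order (kleene_brouwer T)"
  unfolding linear_order_on_def partial_order_on_def preorder_on_def Field_kleene_brouwer
proof (intro conjI)
  show "refl_on T (kleene_brouwer T)"
    by (auto simp: refl_on_def kleene_brouwer_def)
  show "trans (kleene_brouwer T)"
    by (auto simp: trans_def kleene_brouwer_def intro: precedes_trans)
  show "antisym (kleene_brouwer T)"
    using precedes_trans precedes_irrefl by (auto simp: antisym_def kleene_brouwer_def)
  show "total_on T (kleene_brouwer T)"
    using precedes_total by (auto simp: total_on_def kleene_brouwer_def)
qed (auto simp: kleene_brouwer_def)

lemma Suc_prefix: "bit m p \<Longrightarrow> take_bit (Suc p) m = set_bit p (take_bit p m)"
  for m :: nat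
  by (rule bit_eqI) (auto simp: bit_take_bit_iff bit_set_bit_iff less_Suc_eq)

text \<open>\<open>p\<close> is the first element of \<open>m\<close> at or above \<open>k\<close>;
  without one, \<open>m\<close> would equal its prefix \<open>n\<close>.\<close>

lemma next_bit:
  fixes m :: nat
  assumes "take_bit k m = n" "m \<noteq> n"
  obtains p where "bit m p" "take_bit p m = n"
proof -
  have ex: "\<exists>j. k \<le> j \<and> bit m j"
  proof (rule ccontr)
    assume "\<nexists>j. k \<le> j \<and> bit m j"
    then have "take_bit k m = m"
      by (intro bit_eqI) (auto simp: bit_take_bit_iff not_le)
    then show False
      using assms by simp
  qed
  define p where "p = (LEAST j. k \<le> j \<and> bit m j)"
  have p: "k \<le> p" "bit m p"
    using LeastI_ex[OF ex] unfolding p_def by blast+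
  have "j < k" if "bit m j" "j < p" for j
    using that not_less_Least[of j "\<lambda>j. k \<le> j \<and> bit m j"] unfolding p_def by auto
  then have "take_bit p m = take_bit k m"
    using p(1) by (intro bit_eqI) (auto simp: bit_take_bit_iff not_le)
  then show thesis
    using that p assms by simp
qed

text \<open>Induction along the tree for sets \<open>Q\<close> of extensions of \<open>n\<close>.
  Extensions come before \<open>n\<close>, so unless \<open>Q\<close> is just \<open>n\<close>, take
  the least \<open>p\<close> by which a member extends \<open>n\<close>: the members through that
  child precede all others, and the induction hypothesis finds their minimum.\<close>

lemma kleene_brouwer_min:
  assumes T: "\<And>n k. n \<in> T \<Longrightarrow> take_bit k n \<in> T" and wf: "wf (child_rel T)"
    and "Q \<subseteq> T" "Q \<noteq> {}" "\<And>m. m \<in> Q \<Longrightarrow> \<exists>k. take_bit k m = n"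
  shows "\<exists>z\<in>Q. \<forall>y\<in>Q. (z, y) \<in> kleene_brouwer T"
  using wf assms(3-)
proof (induction n arbitrary: Q rule: wf_induct_rule)
  case (less n)
  show ?case
  proof (cases "Q = {n}")
    case True
    then show ?thesis
      using less.prems by (auto simp: kleene_brouwer_def)
  next
    case False
    define ext where "ext = (\<lambda>p m. bit m p \<and> take_bit p m = n)"
    have ext: "\<exists>p. ext p m" if "m \<in> Q" "m \<noteq> n" for m
      using less.prems(3)[OF that(1)] next_bit that(2) unfolding ext_def by metis
    define p where "p = (LEAST p. \<exists>m\<in>Q. ext p m)"
    obtain m where m: "m \<in> Q" "ext p m"
    proof -
      have "\<exists>p. \<exists>m\<in>Q. ext p m"
        using False less.prems(2) ext by blast
      from LeastI_ex[OF this] show thesis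
        using that unfolding p_def by blast
    qed
    have least: "p \<le> q" if "y \<in> Q" "ext q y" for q y
      using that unfolding p_def by (blast intro: Least_le)
    have ext_p: "take_bit (Suc p) y = set_bit p n" if "ext p y" for y
      using that Suc_prefix[of y p] by (auto simp: ext_def)
    let ?Q = "{y \<in> Q. ext p y}"
    have "set_bit p n \<in> T"
      using ext_p[OF m(2)] T m(1) less.prems(1) by (metis subsetD)
    moreover have "n < 2 ^ p"
      using m(2) unfolding ext_def by (metis take_bit_nat_less_exp)
    ultimately have "(set_bit p n, n) \<in> child_rel T"
      unfolding child_rel_def by blast
    moreover have "?Q \<subseteq> T" "?Q \<noteq> {}"
      using less.prems(1) m by blast+
    moreover have "\<exists>k. take_bit k y = set_bit p n" if "y \<in> ?Q" for y
      using ext_p that by blast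
    ultimately obtain z where z: "z \<in> ?Q" "\<And>y. y \<in> ?Q \<Longrightarrow> (z, y) \<in> kleene_brouwer T"
      using less.IH[of "set_bit p n" ?Q] by blast
    have "(z, y) \<in> kleene_brouwer T" if y: "y \<in> Q" for y
    proof (cases "ext p y")
      case True
      then show ?thesis
        using z y by blast
    next
      case False
      \<comment> \<open>Members outside this child agree with \<open>n\<close> up to and including
        position \<open>p\<close>, where \<open>n\<close> has no element.\<close>
      have "\<exists>q>p. take_bit q y = n"
      proof (cases "y = n")
        case True
        have "n < 2 ^ Suc (p + n)"
          by (rule less_le_trans[OF less_exp]) (simp add: power_add)
        then have "take_bit (Suc (p + n)) n = n"
          by (rule take_bit_nat_eq_self)
        then show ?thesis
          using True by (intro exI[of _ "Suc (p + n)"]) auto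
      next
        case False
        then obtain q where "ext q y"
          using ext y by blast
        then show ?thesis
          using least[OF y] \<open>\<not> ext p y\<close> by (metis ext_def order_le_less)
      qed
      then obtain q where q: "q > p" "take_bit q y = n"
        by blast
      have zn: "take_bit p z = n" "bit z p"
        using z(1) by (auto simp: ext_def)
      have "precedes z y"
      proof (rule precedesI[of _ p])
        show "bit z p"
          by (rule zn)
        show "\<not> bit y p"
          using q zn by (metis bit_take_bit_iff less_irrefl)
        show "bit z j = bit y j" if "j < p" for j
          using that q zn by (metis bit_take_bit_iff less_trans)
      qed
      then show ?thesis
        using z(1) y less.prems(1) by (auto simp: kleene_brouwer_def)
    qed
    then show ?thesis
      using z(1) by blast
  qed
qed

lemma Well_order_kleene_brouwer:
  assumes "\<And>n k. n \<in> T \<Longrightarrow> take_bit k n \<in> T" "wf (child_rel T)"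
  shows "Well_order (kleene_brouwer T)"
proof -
  \<comment> \<open>The empty sequence 0 is a prefix of every node.\<close>
  have "\<exists>z\<in>Q. \<forall>y\<in>Q. (z, y) \<in> kleene_brouwer T" if "Q \<subseteq> T" "Q \<noteq> {}" for Q
    using kleene_brouwer_min[OF assms that, of 0] by (metis take_bit_0)
  then show ?thesis
    using Linear_order_Well_order_iff[OF Linear_order_kleene_brouwer]
    by (simp add: Field_kleene_brouwer)
qed

section \<open>Computable ordinals\<close>

lemma Well_order_le: "Well_order {(\<beta>, \<gamma>). \<beta> \<le> (\<gamma> :: ordinal)}"
proof -
  let ?R = "{(\<beta>, \<gamma>). \<beta> \<le> (\<gamma> :: ordinal)}"
  have F: "Field ?R = UNIV"
    by (auto simp: Field_def)
  have "Linear_order ?R"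
    unfolding linear_order_on_def partial_order_on_def preorder_on_def F
    by (auto simp: refl_on_def trans_def antisym_def total_on_def)
  moreover have "\<exists>\<beta>\<in>A. \<forall>\<gamma>\<in>A. \<beta> \<le> \<gamma>" if "A \<noteq> {}" for A :: "ordinal set"
    using that LeastI_ex[of "\<lambda>\<beta>. \<beta> \<in> A"] Least_le[of "\<lambda>\<beta>. \<beta> \<in> A"] by blast
  ultimately show ?thesis
    by (subst Linear_order_Well_order_iff) auto
qed

lemma below_eq_Restr: "below \<alpha> = Restr {(\<beta>, \<gamma>). \<beta> \<le> \<gamma>} (underS {(\<beta>, \<gamma>). \<beta> \<le> \<gamma>} \<alpha>)"
  by (auto simp: below_def underS_def)

lemma Well_order_below: "Well_order (below \<alpha>)"
  unfolding below_eq_Restr by (rule Well_order_Restr) (rule Well_order_le)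

lemma below_ordLess: "\<alpha> < \<beta> \<Longrightarrow> (below \<alpha>, below \<beta>) \<in> ordLess"
proof -
  assume "\<alpha> < \<beta>"
  then have "(\<alpha>, \<alpha>) \<in> below \<beta>"
    by (auto simp: below_def)
  then have "Field (below \<beta>) \<noteq> {}"
    unfolding Field_def by blast
  then have "(Restr (below \<beta>) (underS (below \<beta>) \<alpha>), below \<beta>) \<in> ordLess"
    by (intro underS_Restr_ordLess Well_order_below)
  moreover have "Restr (below \<beta>) (underS (below \<beta>) \<alpha>) = below \<alpha>"
    using \<open>\<alpha> < \<beta>\<close> by (auto simp: underS_def below_def)
  ultimately show ?thesis
    by simp
qed

lemma below_ordIso_cancel: "(below \<alpha>, below \<beta>) \<in> ordIso \<Longrightarrow> \<alpha> = \<beta>"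
  by (metis below_ordLess linorder_neq_iff not_ordLess_ordIso ordIso_symmetric)

text \<open>Otherwise the whole type \<open>ordinal\<close> would embed into a relation on the
  natural numbers, against \<open>no_inj_ordinal\<close>.\<close>

lemma ex_ordinal:
  assumes "Well_order (r :: nat rel)"
  shows "\<exists>\<alpha>. (r, below \<alpha>) \<in> ordIso"
proof -
  let ?R = "{(\<beta>, \<gamma>). \<beta> \<le> (\<gamma> :: ordinal)}"
  have "(?R, r) \<notin> ordLeq"
  proof
    assume "(?R, r) \<in> ordLeq"
    then obtain f where "embed ?R r f"
      by (auto simp: ordLeq_def)
    then have "inj_on f (Field ?R)"
      by (rule embed_inj_on[OF Well_order_le])
    moreover have "Field ?R = UNIV"
      by (auto simp: Field_def)
    ultimately have "inj (\<lambda>x. {f x})"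
      by (auto simp: inj_on_def)
    then show False
      using no_inj_ordinal by blast
  qed
  then have "(r, ?R) \<in> ordLess"
    using ordLess_or_ordLeq[OF assms Well_order_le] by blast
  then show ?thesis
    using ordLess_iff_ordIso_Restr[OF Well_order_le assms] unfolding below_eq_Restr by blast
qed

text \<open>A smaller ordinal is the type of a proper initial segment of \<open>r\<close>, which is
  decided with its endpoint \<open>a\<close> as a constant.\<close>

lemma computable_ordinal_less:
  assumes "computable_ordinal X \<alpha>" "\<gamma> < \<alpha>"
  shows "computable_ordinal X \<gamma>"
proof -
  obtain r where r: "Well_order r" "computable_rel X r" "(r, below \<alpha>) \<in> ordIso"
    using assms(1) unfolding computable_ordinal_def by blast
  have "(below \<gamma>, r) \<in> ordLess"
    using below_ordLess[OF assms(2)] ordIso_symmetric[OF r(3)] by (rule ordLess_ordIso_trans)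
  then obtain a where a: "(below \<gamma>, Restr r (underS r a)) \<in> ordIso"
    using ordLess_iff_ordIso_Restr[OF r(1) Well_order_below] by blast
  have "trans r" "antisym r"
    using r(1) by (auto simp: order_on_defs)
  then have "(m, n) \<in> Restr r (underS r a) \<longleftrightarrow> (m, n) \<in> r \<and> (n, a) \<in> r \<and> n \<noteq> a" for m n
    unfolding underS_def by (auto dest: transD antisymD)
  moreover have "tdec X 2 (\<lambda>e. (e 0, e 1) \<in> r \<and> (e 1, a) \<in> r \<and> e 1 \<noteq> a)"
    by (intro tdec_conj tdec_not tdec_eq tcomp_comp2[OF computable_relD[OF r(2)]] tcomp_const
        tcomp_var) auto
  ultimately have "computable_rel X (Restr r (underS r a))"
    by (intro computable_relI) (simp only:)
  then show ?thesis
    using Well_order_Restr[OF r(1)] ordIso_symmetric[OF a] unfolding computable_ordinal_def by blast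
qed

text \<open>Downward closure would otherwise make \<open>omega1 X\<close> itself computable.\<close>

lemma less_omega1:
  assumes "computable_ordinal X \<alpha>"
  shows "\<alpha> < omega1 X"
proof (rule ccontr)
  assume "\<not> \<alpha> < omega1 X"
  then have "computable_ordinal X (omega1 X)"
    using assms computable_ordinal_less by (metis linorder_neqE)
  then show False
    using LeastI_ex[OF ex_not_computable_ordinal[of X]] unfolding omega1_def by blast
qed

instance recfn :: countable
  by countable_datatype

text \<open>Each such ordinal is the type of a relation computed by some index, and there are only
  countably many indices.\<close>

lemma countable_less_omega1: "countable {\<alpha>. \<alpha> < omega1 X}"
proof -
  let ?r = "\<lambda>F. {(a, b). calc X F [a, b] 1}"
  have "\<alpha> \<in> range (\<lambda>F. SOME \<alpha>. (?r F, below \<alpha>) \<in> ordIso)" if "\<alpha> < omega1 X" for \<alpha>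
  proof -
    have "computable_ordinal X \<alpha>"
      using that not_less_Least unfolding omega1_def by blast
    then obtain r where r: "(r, below \<alpha>) \<in> ordIso" "computable_rel X r"
      unfolding computable_ordinal_def by blast
    from r(2) obtain F
      where F: "\<forall>a b c. Some (if (a, b) \<in> r then 1 else 0) = Some c \<longleftrightarrow> calc X F [a, b] c"
      unfolding computable_rel_def partial_computable2_def by (rule exE)
    have "(a, b) \<in> r \<longleftrightarrow> calc X F [a, b] 1" for a b
      using F[rule_format, of a b 1] by (simp split: if_splits)
    then have eq: "?r F = r"
      by auto
    have "(SOME \<beta>. (r, below \<beta>) \<in> ordIso) = \<alpha>"
    proof (rule some_equality)
      show "\<beta> = \<alpha>" if "(r, below \<beta>) \<in> ordIso" for \<beta>
        by (rule below_ordIso_cancel[OF ordIso_transitive[OF ordIso_symmetric[OF that] r(1)]])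
    qed (rule r)
    then show ?thesis
      by (intro range_eqI[of _ _ F]) (simp only: eq)
  qed
  then show ?thesis
    by (intro countable_subset[OF _ countable_image[OF countableI_type]]) blast
qed

section \<open>Sequences of arguments\<close>

text \<open>
  The set \<open>p\<^sub>0 < p\<^sub>1 < \<dots>\<close> encodes the sequence of arguments \<open>countdown p\<^sub>0, countdown p\<^sub>1, \<dots>\<close>. Since
  \<open>countdown\<close> takes every value infinitely often, \<open>p\<^sub>i\<close> can be chosen above any bound.
\<close>

primrec countdown :: "nat \<Rightarrow> nat" where
  "countdown 0 = 0"
| "countdown (Suc j) = (if countdown j = 0 then Suc j else countdown j - 1)"

lemma countdown_add: "d \<le> countdown j \<Longrightarrow> countdown (j + d) = countdown j - d"
  by (induction d) auto

lemma countdown_hits: "\<exists>j\<ge>b. countdown j = x"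
proof -
  \<comment> \<open>This is the first zero of \<open>countdown\<close> from \<open>max b x\<close>
    on; the next value is \<open>Suc j\<close>, and the descent from there passes
    \<open>x\<close>.\<close>
  define j where "j = max b x + countdown (max b x)"
  have j: "countdown j = 0" "max b x \<le> j"
    using countdown_add[of "countdown (max b x)" "max b x"] by (auto simp: j_def)
  then have "countdown (Suc j + (Suc j - x)) = x"
    using countdown_add[of "Suc j - x" "Suc j"] by simp
  then show ?thesis
    using j(2) by (intro exI[of _ "Suc j + (Suc j - x)"]) auto
qed

lemma tcomp_countdown:
  assumes "tcomp X n a"
  shows "tcomp X n (\<lambda>e. countdown (a e))"
proof (rule tcomp_comp1[OF _ assms])
  have "tcomp X 1 (\<lambda>e. rec_nat 0 (\<lambda>i y. if y = 0 then Suc i else y - 1) (e 0))"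
    by (intro tcomp_rec tcomp_if tdec_eq tcomp_const tcomp_Suc tcomp_pred tcomp_var) auto
  moreover have "rec_nat 0 (\<lambda>i y. if y = 0 then Suc i else y - 1) m = countdown m" for m
    by (induction m) auto
  ultimately show "tcomp X 1 (\<lambda>e. countdown (e 0))"
    by (simp only:)
qed

text \<open>One fold serves both for terms and for codes of their approximate values, so facts on
  prefixes are shared.\<close>

definition along :: "('b \<Rightarrow> nat \<Rightarrow> 'b) \<Rightarrow> 'b \<Rightarrow> nat \<Rightarrow> nat \<Rightarrow> 'b" where
  "along f z n k = rec_nat z (\<lambda>j v. if bit n j then f v (countdown j) else v) k"

lemma along_0: "along f z n 0 = z"
  and along_Suc: "along f z n (Suc k) = (if bit n k then f (along f z n k) (countdown k) else along f z n k)"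
  by (simp_all add: along_def)

lemma along_cong: "(\<And>j. j < k \<Longrightarrow> bit m j = bit n j) \<Longrightarrow> along f z m k = along f z n k"
  by (induction k) (auto simp: along_0 along_Suc)

lemma along_ge: "n < 2 ^ k \<Longrightarrow> k \<le> l \<Longrightarrow> along f z n l = along f z n k"
  by (induction l) (auto simp: along_Suc le_Suc_eq not_bit_if_less)

lemma along_set_bit: "along f z (set_bit p n) (Suc p) = f (along f z n p) (countdown p)"
  using along_cong[of p "set_bit p n" n f z] by (simp add: along_Suc bit_set_bit_iff)

lemma set_bit_less: "n < 2 ^ p \<Longrightarrow> set_bit p n < 2 ^ Suc p" for n :: nat
  by (simp add: set_bit_eq)

text \<open>Follows the convention of stages, with 0 for undefined, so that codes of values are
  limits of stages.\<close>

fun enc :: "nat option \<Rightarrow> nat" where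
  "enc None = 0"
| "enc (Some a) = Suc a"

lemma enc_inject: "enc u = enc v \<longleftrightarrow> u = v"
  by (cases u; cases v) auto

abbreviation apps :: "nat cterm \<Rightarrow> nat \<Rightarrow> nat \<Rightarrow> nat cterm" where
  "apps \<equiv> along (\<lambda>s x. App s (Elem x))"

text \<open>0 is absorbing, so undefinedness propagates as in \<open>val\<close>.\<close>

definition app_stage :: "(nat \<Rightarrow> nat list \<Rightarrow> nat) \<Rightarrow> nat \<Rightarrow> nat \<Rightarrow> nat \<Rightarrow> nat" where
  "app_stage h l v x = (if v = 0 then 0 else h l [v - 1, x])"

locale staged_application =
  fixes app :: "nat \<Rightarrow> nat \<Rightarrow> nat option" and X :: "nat set" and h :: "nat \<Rightarrow> nat list \<Rightarrow> nat"
    and F :: recfn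
  assumes app: "\<And>a b c. app a b = Some c \<longleftrightarrow> calc X F [a, b] c"
    and h: "stages X F 2 h"
begin

lemma eventually_h: "\<forall>\<^sub>F l in sequentially. h l [a, b] = enc (app a b)"
proof (cases "app a b")
  case None
  have "h l [a, b] = 0" for l
    using stages_sound[OF h, of "[a, b]" l "h l [a, b] - 1"] None app[of a b] by (cases "h l [a, b]") auto
  then show ?thesis
    using None by simp
next
  case (Some c)
  then have "calc X F [a, b] c"
    using app by blast
  then show ?thesis
    using stages_complete[OF h, of "[a, b]" c] Some by simp
qed

text \<open>Only finitely many applications are involved, and each stabilizes, an undefined one at
  0.\<close>

lemma eventually_along:
  "\<forall>\<^sub>F l in sequentially. along (app_stage h l) (enc (val app s)) n k = enc (val app (apps s n k))"
proof (induction k)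
  case (Suc k)
  show ?case
  proof (cases "val app (apps s n k)")
    case None
    with Suc show ?thesis
      by (auto simp: along_Suc app_stage_def elim!: eventually_mono)
  next
    case (Some a)
    from Suc eventually_h[of a "countdown k"] show ?thesis
      by eventually_elim (use Some in \<open>auto simp: along_Suc app_stage_def\<close>)
  qed
qed (simp add: along_0)

text \<open>
  Distinctness of \<open>s\<close> and \<open>t\<close> after the argument encoded by \<open>j\<close> is only \<open>\<Sigma>\<^sub>2\<close>; \<open>j\<close> also serves as a
  witness, namely as a stage from which on the approximations differ. A node \<open>n\<close> is checked up to
  stage \<open>n\<close>.
\<close>

definition tree :: "nat cterm \<Rightarrow> nat cterm \<Rightarrow> nat set" where
  "tree s t = {n. \<forall>l<Suc n. \<forall>j<Suc l. bit n j \<longrightarrow>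
     along (app_stage h l) (enc (val app s)) n (Suc j) \<noteq>
     along (app_stage h l) (enc (val app t)) n (Suc j)}"

text \<open>The start \<open>z\<close> is a fixed number built into the program; this is how the
  values of \<open>s\<close> and \<open>t\<close> enter.\<close>

lemma tcomp_along:
  assumes "tcomp X m l" "tcomp X m n" "tcomp X m k"
  shows "tcomp X m (\<lambda>e. along (app_stage h (l e)) z (n e) (k e))"
proof (rule tcomp_comp3[OF _ assms])
  have *: "tcomp X 5 (\<lambda>e. h (e 2) (map (\<lambda>i. (if i = 0 then e 1 - 1 else countdown (e 0))) [0..<2]))"
    by (intro stages_tcomp[OF h] tcomp_if tdec_eq tcomp_pred tcomp_countdown tcomp_const tcomp_var)
      auto
  show "tcomp X 3 (\<lambda>e. along (app_stage h (e 0)) z (e 1) (e 2))"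
    unfolding along_def app_stage_def
    by (intro tcomp_rec tcomp_if tdec_bit tdec_eq tcomp_const tcomp_var)
      (use * in \<open>auto simp: upt_rec numeral_eq_Suc\<close>)
qed

text \<open>The cutoff at stage \<open>n\<close> keeps all quantifiers bounded by the node.\<close>

lemma tdec_tree:
  assumes "tcomp X m a"
  shows "tdec X m (\<lambda>e. a e \<in> tree s t)"
proof (rule tcomp_comp1[OF _ assms])
  have "tdec X 1 (\<lambda>e. \<forall>l<Suc (e 0). \<forall>j<Suc l. \<not> (bit (e 0) j \<and>
    along (app_stage h l) (enc (val app s)) (e 0) (Suc j) =
    along (app_stage h l) (enc (val app t)) (e 0) (Suc j)))"
    by (intro tdec_all_less tdec_not tdec_conj tdec_bit tdec_eq tcomp_along tcomp_Suc tcomp_var) auto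
  then show "tdec X 1 (\<lambda>e. e 0 \<in> tree s t)"
    by (simp add: tree_def)
qed

text \<open>A prefix is at most \<open>n\<close>, so it is checked only at stages where
  \<open>n\<close> is checked, and for its own elements the folds read only digits that it
  keeps.\<close>

lemma take_bit_in_tree:
  assumes "n \<in> tree s t"
  shows "take_bit k n \<in> tree s t"
  unfolding tree_def
proof (intro CollectI allI impI)
  fix l j
  assume l: "l < Suc (take_bit k n)" "j < Suc l" "bit (take_bit k n) j"
  then have "bit n j" "j < k"
    by (auto simp: bit_take_bit_iff)
  moreover have "l < Suc n"
    using l(1) take_bit_nat_less_eq_self[of k n] by linarith
  moreover have "along f z (take_bit k n) (Suc j) = along f z n (Suc j)" for f :: "nat \<Rightarrow> nat \<Rightarrow> nat" and z
    using \<open>j < k\<close> by (intro along_cong) (auto simp: bit_take_bit_iff)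
  ultimately show "along (app_stage h l) (enc (val app s)) (take_bit k n) (Suc j) \<noteq>
    along (app_stage h l) (enc (val app t)) (take_bit k n) (Suc j)"
    using assms l(2) by (auto simp: tree_def)
qed

lemma tdec_kleene_brouwer: "tdec X 2 (\<lambda>e. (e 0, e 1) \<in> kleene_brouwer (tree s t))"
proof -
  have *: "tdec X m (\<lambda>e. P e \<longleftrightarrow> Q e)" if "tdec X m P" "tdec X m Q" for m P Q
    using tdec_disj[OF tdec_conj[OF that] tdec_conj[OF that[THEN tdec_not]]]
    by (rule back_subst[of "tcomp X m"]) auto
  show ?thesis
    unfolding kleene_brouwer_def precedes_def mem_Collect_eq prod.case
    by (intro tdec_conj tdec_disj tdec_tree tdec_eq tdec_ex_less tdec_all_less tdec_not tdec_bit *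
        tcomp_var) auto
qed

end

section \<open>Agreement along infinite argument sequences\<close>

lemma sim_App: "sim app \<alpha> s t \<Longrightarrow> sim app \<alpha> (App s (Elem x)) (App t (Elem x))"
  using sim_le_osuc[of app \<alpha> s t] by (simp add: sim_osuc)

lemma sim_apps: "sim app \<alpha> s t \<Longrightarrow> sim app \<alpha> (apps s n k) (apps t n k)"
  by (induction k) (auto simp: along_0 along_Suc intro: sim_App)

text \<open>A successor step consumes one argument and shifts the sequence; a limit passes to a
  smaller index. Equality is claimed after at least one application, so that there is a last
  argument to refer to.\<close>

lemma sim_imp_eventually_kleene_eq:
  assumes "sim app \<alpha> (s 0) (t 0)"
    and "\<And>i. s (Suc i) = App (s i) (Elem (x i))" "\<And>i. t (Suc i) = App (t i) (Elem (x i))"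
  shows "\<exists>i. kleene_eq app (s (Suc i)) (t (Suc i))"
  using assms
proof (induction \<alpha> "s 0" "t 0" arbitrary: s t x rule: sim.induct)
  case zero
  then show ?case
    by (intro exI[of _ 0]) (simp add: kleene_eq_def)
next
  case (suc \<alpha>)
  from suc.hyps(2)[of "x 0" "\<lambda>i. s (Suc i)" "\<lambda>i. t (Suc i)" "\<lambda>i. x (Suc i)"] suc.prems
  show ?case
    by metis
qed blast

context staged_application
begin

text \<open>An infinite branch is an infinite argument sequence, along which \<open>s\<close> and
  \<open>t\<close> become equal after some \<open>p i\<close>. But the nodes are unbounded, so their
  checks make the approximations differ at every stage \<open>l \<ge> p i\<close>, hence also the
  limits.\<close>

lemma wf_tree:
  assumes sim: "sim app \<alpha> s t"
  shows "wf (child_rel (tree s t))"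
  unfolding wf_iff_no_infinite_down_chain
proof
  assume "\<exists>f. \<forall>i. (f (Suc i), f i) \<in> child_rel (tree s t)"
  then obtain f where f: "\<forall>i. (f (Suc i), f i) \<in> child_rel (tree s t)"
    by (rule exE)
  have "\<forall>i. \<exists>p. f (Suc i) = set_bit p (f i) \<and> f i < 2 ^ p \<and> f (Suc i) \<in> tree s t"
  proof
    fix i
    show "\<exists>p. f (Suc i) = set_bit p (f i) \<and> f i < 2 ^ p \<and> f (Suc i) \<in> tree s t"
      using f[rule_format, of i] by (auto simp: child_rel_def)
  qed
  from choice[OF this] obtain p where "\<forall>i. f (Suc i) = set_bit (p i) (f i) \<and> f i < 2 ^ p i \<and>
    f (Suc i) \<in> tree s t"
    by (rule exE)
  then have f: "f (Suc i) = set_bit (p i) (f i)" "f i < 2 ^ p i" and tree: "f (Suc i) \<in> tree s t" for i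
    by (rule allE[of _ i], blast)+
  have less: "p i < p (Suc i)" for i
  proof (rule ccontr)
    assume "\<not> p i < p (Suc i)"
    then show False
      using not_bit_if_less[OF f(2), of "Suc i" "p i"] by (simp add: f(1) bit_set_bit_iff)
  qed
  have mono: "p i \<le> p j" if "i \<le> j" for i j
    using lift_Suc_mono_le[of p, OF less_imp_le[OF less] that] .
  \<comment> \<open>No element lies between \<open>p i\<close> and \<open>p (Suc i)\<close>, so the
    next node applies exactly one more argument.\<close>
  have step: "apps u (f (Suc i)) (p (Suc i)) = App (apps u (f i) (p i)) (Elem (countdown (p i)))"
    for u i
    using along_ge[OF set_bit_less[OF f(2)], of i "p (Suc i)"] less[of i]
    by (simp add: f(1) along_set_bit)
  obtain i where eq: "kleene_eq app (apps s (f (Suc i)) (p (Suc i))) (apps t (f (Suc i)) (p (Suc i)))"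
    using sim_imp_eventually_kleene_eq[of app \<alpha> "\<lambda>i. apps s (f i) (p i)" "\<lambda>i. apps t (f i) (p i)",
        OF sim_apps[OF sim] step step] by blast
  \<comment> \<open>Later nodes change no digit up to \<open>p i\<close>.\<close>
  have prefix: "along g z (f (Suc i + d)) (Suc (p i)) = along g z (f (Suc i)) (Suc (p i))"
    for d z and g :: "nat \<Rightarrow> nat \<Rightarrow> nat"
  proof (induction d)
    case (Suc d)
    have "along g z (set_bit (p (Suc i + d)) (f (Suc i + d))) (Suc (p i)) =
      along g z (f (Suc i + d)) (Suc (p i))"
      using mono[of "Suc i" "Suc i + d"] less[of i]
      by (intro along_cong) (auto simp: bit_set_bit_iff)
    then show ?case
      using Suc by (simp add: f(1))
  qed simp
  have bits: "bit (f (Suc i + d)) (p i)" for d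
    by (induction d) (auto simp: f(1) bit_set_bit_iff)
  have large: "d \<le> f (Suc i + d)" for d
  proof -
    have "d \<le> p (i + d)"
      using less by (induction d) (auto simp: Suc_le_eq intro: le_less_trans)
    also have "\<dots> < f (Suc i + d)"
      by (intro bit_less) (simp add: f(1) bit_set_bit_iff)
    finally show ?thesis
      by simp
  qed
  have "along (app_stage h l) (enc (val app s)) (f (Suc i)) (Suc (p i)) \<noteq>
    along (app_stage h l) (enc (val app t)) (f (Suc i)) (Suc (p i))" if "p i \<le> l" for l
  proof -
    have "f (Suc i + l) \<in> tree s t"
      using tree[of "i + l"] by simp
    moreover have "l < Suc (f (Suc i + l))" "p i < Suc l"
      using large[of l] that by auto
    ultimately have "along (app_stage h l) (enc (val app s)) (f (Suc i + l)) (Suc (p i)) \<noteq>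
      along (app_stage h l) (enc (val app t)) (f (Suc i + l)) (Suc (p i))"
      using bits[of l] unfolding tree_def by blast
    then show ?thesis
      unfolding prefix .
  qed
  then have "\<forall>\<^sub>F l in sequentially. along (app_stage h l) (enc (val app s)) (f (Suc i)) (Suc (p i)) \<noteq>
    along (app_stage h l) (enc (val app t)) (f (Suc i)) (Suc (p i))"
    by (rule eventually_sequentiallyI)
  with eventually_along[of s "f (Suc i)" "Suc (p i)"] eventually_along[of t "f (Suc i)" "Suc (p i)"]
  have "\<forall>\<^sub>F l in sequentially. val app (apps s (f (Suc i)) (Suc (p i))) \<noteq>
    val app (apps t (f (Suc i)) (Suc (p i)))"
    by eventually_elim auto
  then have "val app (apps s (f (Suc i)) (Suc (p i))) \<noteq> val app (apps t (f (Suc i)) (Suc (p i)))"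
    by simp
  moreover have "apps u (f (Suc i)) (p (Suc i)) = apps u (f (Suc i)) (Suc (p i))" for u
    using along_ge[OF set_bit_less[OF f(2)], of i "p (Suc i)"] less[of i] by (simp add: f(1))
  ultimately show False
    using eq by (simp add: kleene_eq_def)
qed

text \<open>Induction on the rank. If the values differ after a further argument \<open>x\<close>,
  their approximations differ from some stage \<open>b\<close> on, and extending \<open>n\<close> by
  a code \<open>p \<ge> b\<close> of \<open>x\<close> gives a child of smaller rank. Assumption
  \<open>true\<close> concerns all stages, while membership in the tree tests them only up to
  \<open>n\<close>.\<close>

lemma sim_rank:
  fixes rk :: "nat \<Rightarrow> ordinal"
  assumes rk: "\<And>m n. (m, n) \<in> child_rel (tree s t) \<Longrightarrow> n \<in> tree s t \<Longrightarrow> rk m < rk n"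
    and "n < 2 ^ k"
    and true: "\<And>j l. bit n j \<Longrightarrow> j \<le> l \<Longrightarrow>
      along (app_stage h l) (enc (val app s)) n (Suc j) \<noteq>
      along (app_stage h l) (enc (val app t)) n (Suc j)"
  shows "sim app (osuc (rk n)) (apps s n k) (apps t n k)"
  using assms(2-)
proof (induction "rk n" arbitrary: n k rule: less_induct)
  case less
  let ?s = "apps s n k" and ?t = "apps t n k"
  have n: "n \<in> tree s t"
    unfolding tree_def by (intro CollectI allI impI less.prems(2)) auto
  have "sim app (rk n) (App ?s (Elem x)) (App ?t (Elem x))" for x
  proof (cases "val app (App ?s (Elem x)) = val app (App ?t (Elem x))")
    case True
    then show ?thesis
      by (intro sim_mono[OF ozero_le sim.zero]) (simp only: kleene_eq_def)
  next
    case False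
    have ev: "\<forall>\<^sub>F l in sequentially. app_stage h l (along (app_stage h l) (enc (val app u)) n k) x
      = enc (val app (App (apps u n k) (Elem x)))" for u
    proof -
      obtain p where p: "countdown p = x" "k \<le> p"
        using countdown_hits by blast
      have "apps u n p = apps u n k"
        "along (app_stage h l) (enc (val app u)) n p = along (app_stage h l) (enc (val app u)) n k" for l
        by (rule along_ge[OF less.prems(1) p(2)])+
      then show ?thesis
        using eventually_along[of u "set_bit p n" "Suc p"] unfolding along_set_bit p(1) by simp
    qed
    have "\<forall>\<^sub>F l in sequentially.
      app_stage h l (along (app_stage h l) (enc (val app s)) n k) x \<noteq>
      app_stage h l (along (app_stage h l) (enc (val app t)) n k) x"
      using ev[of s] ev[of t] by eventually_elim (use False in \<open>simp add: enc_inject\<close>)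
    then obtain b where b: "\<And>l. b \<le> l \<Longrightarrow>
      app_stage h l (along (app_stage h l) (enc (val app s)) n k) x \<noteq>
      app_stage h l (along (app_stage h l) (enc (val app t)) n k) x"
      unfolding eventually_sequentially by blast
    \<comment> \<open>\<open>p \<ge> k\<close> puts the new element above \<open>n\<close>, and
      \<open>p \<ge> b\<close> makes it a valid witness stage.\<close>
    obtain p where p: "countdown p = x" "max k b \<le> p"
      using countdown_hits by blast
    let ?m = "set_bit p n"
    have np: "n < 2 ^ p"
      using p(2) by (intro less_le_trans[OF less.prems(1)] power_increasing) auto
    have along_p: "along f z ?m (Suc p) = f (along f z n k) x" for f :: "'b \<Rightarrow> nat \<Rightarrow> 'b" and z
      using along_ge[OF less.prems(1), of p f z] p by (simp add: along_set_bit)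
    have true: "along (app_stage h l) (enc (val app s)) ?m (Suc j) \<noteq>
      along (app_stage h l) (enc (val app t)) ?m (Suc j)" if "bit ?m j" "j \<le> l" for j l
    proof (cases "j = p")
      case True
      then show ?thesis
        using b[of l] p(2) that(2) by (simp add: along_p)
    next
      case False
      with that(1) have j: "bit n j"
        by (simp add: bit_set_bit_iff)
      then have "j < p"
        using np not_bit_if_less not_le by blast
      then have "along f z ?m (Suc j) = along f z n (Suc j)" for f :: "nat \<Rightarrow> nat \<Rightarrow> nat" and z
        by (intro along_cong) (auto simp: bit_set_bit_iff)
      then show ?thesis
        using less.prems(2)[OF j that(2)] by simp
    qed
    have "?m \<in> tree s t"
      unfolding tree_def by (intro CollectI allI impI true) auto
    then have lt: "rk ?m < rk n"
      using np by (intro rk n) (auto simp: child_rel_def)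
    have "sim app (osuc (rk ?m)) (apps s ?m (Suc p)) (apps t ?m (Suc p))"
      by (rule less.hyps[OF lt set_bit_less[OF np] true])
    moreover have "osuc (rk ?m) \<le> rk n"
      using lt by (simp add: osuc_le_iff)
    ultimately show ?thesis
      unfolding along_p by (rule sim_mono[rotated])
  qed
  then show ?case
    by (simp add: sim_osuc)
qed

text \<open>The rank is the isomorphism of the Kleene--Brouwer order onto the ordinals below its
  computable order type \<open>\<beta>\<close>.\<close>

lemma sim_omega1:
  assumes "sim app \<alpha> s t"
  shows "sim app (omega1 X) s t"
proof -
  let ?r = "kleene_brouwer (tree s t)"
  have wo: "Well_order ?r"
    by (rule Well_order_kleene_brouwer[OF take_bit_in_tree wf_tree[OF assms]])
  obtain \<beta> where iso: "(?r, below \<beta>) \<in> ordIso"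
    using ex_ordinal[OF wo] by blast
  then obtain rk where rk: "iso ?r (below \<beta>) rk"
    unfolding ordIso_def by blast
  have "computable_ordinal X \<beta>"
    unfolding computable_ordinal_def using wo iso computable_relI[OF tdec_kleene_brouwer] by blast
  then have "\<beta> < omega1 X"
    by (rule less_omega1)
  have le: "rk m \<le> rk n" "rk n < \<beta>" if "(m, n) \<in> ?r" for m n
    using iso_forward[OF that rk] by (auto simp: below_def)
  have "rk m < rk n" if "(m, n) \<in> child_rel (tree s t)" "n \<in> tree s t" for m n
  proof -
    from that(1) obtain p where p: "m = set_bit p n" "n < 2 ^ p" "m \<in> tree s t"
      unfolding child_rel_def by blast
    have bit: "bit m p" "\<not> bit n p"
      using p by (auto simp: bit_set_bit_iff not_bit_if_less)
    then have "precedes m n"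
      using p(1) by (intro precedesI[of m p n]) (auto simp: bit_set_bit_iff)
    then have "(m, n) \<in> ?r"
      using that(2) p(3) by (simp add: kleene_brouwer_def)
    moreover have "inj_on rk (tree s t)"
      using rk unfolding iso_def bij_betw_def Field_kleene_brouwer by blast
    then have "rk m \<noteq> rk n"
      using bit that(2) p(3) by (auto dest: inj_onD)
    ultimately show ?thesis
      using le(1) by (metis order_le_less)
  qed
  \<comment> \<open>The root 0 encodes no arguments: its terms are \<open>s\<close> and
    \<open>t\<close>, and the assumption on its digits is vacuous.\<close>
  from sim_rank[OF this, where n = 0 and k = 0] have "sim app (osuc (rk 0)) s t"
    by (simp add: along_0)
  moreover have "0 \<in> tree s t"
    by (simp add: tree_def)
  then have "rk 0 < \<beta>"
    using le(2)[of 0 0] by (simp add: kleene_brouwer_def)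
  then have "osuc (rk 0) \<le> omega1 X"
    using \<open>\<beta> < omega1 X\<close> by (simp add: osuc_le_iff)
  ultimately show ?thesis
    by (rule sim_mono[rotated])
qed

end

theorem theorem5p8:
  fixes app :: "nat \<Rightarrow> nat \<Rightarrow> nat option" and X :: "nat set"
  assumes "pca app"
    and "partial_computable2 X app"
  shows "pca_ord app \<le> omega1 X \<and> countable {\<alpha>. \<alpha> < pca_ord app}"
proof -
  obtain F where F: "\<And>a b c. app a b = Some c \<longleftrightarrow> calc X F [a, b] c"
    using assms(2) unfolding partial_computable2_def by blast
  obtain h where "stages X F 2 h"
    using ex_stages by blast
  then interpret staged_application app X h F
    by unfold_locales (rule F)
  \<comment> \<open>Every relation is contained in the one at \<open>omega1 X\<close>, in particular
    the next one, so the sequence is stationary there.\<close>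
  have "sim app (omega1 X) = sim app (osuc (omega1 X))"
    by (intro ext iffI) (blast intro: sim_omega1 sim_le_osuc)+
  then have le: "pca_ord app \<le> omega1 X"
    unfolding pca_ord_def by (rule Least_le)
  then have "{\<alpha>. \<alpha> < pca_ord app} \<subseteq> {\<alpha>. \<alpha> < omega1 X}"
    by auto
  then show ?thesis
    using le countable_less_omega1 countable_subset by blast
qed

end
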